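(* The affine quantum version of the Poisson algebra on pairs $(\mathbb A,B)$ of type (ii) (recalled in the context) reads: $$R_{12}(\lambda,\mu;q)\overset{1}{\mathbb A}(\lambda)R_{12}^{t_1}(\lambda^{-1},\mu;q)\overset{2}{\mathbb A}(\mu)=\overset{2}{\mathbb A}(\mu)R_{12}^{t_1}(\lambda^{-1},\mu;q)\overset{1}{\mathbb A}(\lambda)R_{12}(\lambda,\mu;q),$$ $$R_{12}(\lambda,\mu;q)\overset{1}{B}(\lambda)\overset{2}{B}(\mu)=\overset{2}{B}(\mu)\overset{1}{B}(\lambda)R_{12}(\lambda,\mu;q),$$ $$\overset{2}{\mathbb A}(\mu)\overset{1}{B}(\lambda)R_{12}(\lambda,\mu;q)=\overset{1}{B}(\lambda)R_{12}^{t_2}(\mu,\lambda^{-1};q^{-1})\overset{2}{\mathbb A}(\mu),$$ where in the last relation one can equivalently substitute $R_{12}^{t_2}(\mu,\lambda^{-1};q^{-1})=R_{12}^{t_2}(\lambda,\mu^{-1};q^{-1})$. These commutation relations satisfy the Jacobi relations and ensure the quantum automorphism: the products $$\mathbb A'(\lambda):=B(\lambda)\mathbb A(\lambda)B^{\mathrm T}(\lambda^{-1})$$ satisfy the relation $$R_{12}(\lambda,\mu;q)\overset{1}{\mathbb A'}(\lambda)R_{12}^{t_1}(\lambda^{-1},\mu;q)\overset{2}{\mathbb A'}(\mu)=\overset{2}{\mathbb A'}(\mu)R_{12}^{t_1}(\lambda^{-1},\mu;q)\overset{1}{\mathbb A'}(\lambda)R_{12}(\lambda,\mu;q).$$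
   Context: $E_{i,j}$ are the $N\times N$ matrix units. The generators are collected in $$\mathbb A(\lambda)=\sum_{i,j}\sum_{k=0}^\infty E_{i,j}\otimes a_{i,j}^{(k)}\lambda^{-k},\qquad B(\lambda)=\sum_{i,j}\sum_{k=0}^\infty E_{i,j}\otimes b_{i,j}^{(k)}\lambda^{-k},$$ with $a_{i,j}^{(k)},b_{i,j}^{(k)}$ elements of a noncommutative associative algebra commuting with entries of $R$-matrices. The quantum affine $R$-matrix is $$R_{12}(\lambda,\mu;q):=\frac{\lambda-\mu}{q^{-1}\lambda-q\mu}\sum_{i\ne j}E_{i,i}\otimes E_{j,j}+\sum_iE_{i,i}\otimes E_{i,i}+\frac{(q^{-1}-q)\lambda}{q^{-1}\lambda-q\mu}\sum_{i<j}E_{i,j}\otimes E_{j,i}+\frac{(q^{-1}-q)\mu}{q^{-1}\lambda-q\mu}\sum_{i>j}E_{i,j}\otimes E_{j,i}.$$ $\overset{1}{X}$, $\overset{2}{X}$ denote $X$ acting in the first, second classical tensor factor; $t_1,t_2$ denote transposition in the first, second classical factor. The order of multiplication of operators is the natural one: it coincides with the ordering of the matrices in matrix products; transposition $B^{\mathrm T}$ only exchanges matrix indices. "Jacobi relations" means consistency of the quadratic relations on triples: using the relations, the two ways of reversing the order of a product of three of the matrices (in spaces $1,2,3$ with three spectral parameters) give the same result. The type (ii) Poisson algebra is: with $r_{12}=\sum_iE_{i,i}\otimes E_{i,i}+2\sum_{i>j}E_{i,j}\otimes E_{j,i}$, $\{\overset{1}{\mathbb A},\overset{2}{\mathbb A}\}=r_{12}\overset{1}{\mathbb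 A}\overset{2}{\mathbb A}-\overset{1}{\mathbb A}\overset{2}{\mathbb A}r_{12}+\overset{1}{\mathbb A}r_{12}^{t_1}\overset{2}{\mathbb A}-\overset{2}{\mathbb A}r_{12}^{t_1}\overset{1}{\mathbb A}$, $\{\overset{1}{B},\overset{2}{B}\}=r_{12}\overset{1}{B}\overset{2}{B}-\overset{1}{B}\overset{2}{B}r_{12}$, $\{\overset{1}{B},\overset{2}{\mathbb A}\}=-\overset{1}{B}r_{12}^{t_2}\overset{2}{\mathbb A}-\overset{1}{B}\overset{2}{\mathbb A}r_{12}$. *)

theory Defs
  imports "HOL-Analysis.Analysis"
begin

text \<open>
  The index type \<^typ>\<open>'n\<close> (finite and linearly ordered) plays the role of \<open>{1, ..., N}\<close>.
  Operators on the tensor square of the classical space are matrices indexed by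
  \<^typ>\<open>'n \<times> 'n\<close>, first component for the first tensor factor. Scalars (spectral parameters,
  \<open>q\<close>, entries of R-matrices) lie in a field \<^typ>\<open>'k\<close>, the quantum algebra is a ring
  \<^typ>\<open>'a\<close> receiving the scalars through a homomorphism into its centre.
\<close>

definition central_hom :: "('k::field \<Rightarrow> 'a::ring_1) \<Rightarrow> bool" where
  "central_hom h \<longleftrightarrow> h 1 = 1 \<and> (\<forall>c d. h (c + d) = h c + h d) \<and> (\<forall>c d. h (c * d) = h c * h d)
     \<and> (\<forall>c x. h c * x = x * h c)"

definition mat_unit :: "'n::finite \<Rightarrow> 'n \<Rightarrow> 'r::ring_1^'n^'n" where
  "mat_unit i j = axis i (axis j 1)"

definition kron :: "'r::ring_1^'n::finite^'n \<Rightarrow> 'r^'n^'n \<Rightarrow> 'r^('n \<times> 'n)^('n \<times> 'n)"  (infixl "\<otimes>\<^sub>m" 75) where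
  "X \<otimes>\<^sub>m Y = (\<chi> r c. X $ fst r $ fst c * Y $ snd r $ snd c)"

definition space1 :: "'r::ring_1^'n::finite^'n \<Rightarrow> 'r^('n \<times> 'n)^('n \<times> 'n)" where
  "space1 X = X \<otimes>\<^sub>m mat 1"

definition space2 :: "'r::ring_1^'n::finite^'n \<Rightarrow> 'r^('n \<times> 'n)^('n \<times> 'n)" where
  "space2 X = mat 1 \<otimes>\<^sub>m X"

definition transp1 :: "'r^('n::finite \<times> 'n)^('n \<times> 'n) \<Rightarrow> 'r^('n \<times> 'n)^('n \<times> 'n)" where
  "transp1 M = (\<chi> r c. M $ (fst c, snd r) $ (fst r, snd c))"

definition transp2 :: "'r^('n::finite \<times> 'n)^('n \<times> 'n) \<Rightarrow> 'r^('n \<times> 'n)^('n \<times> 'n)" where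
  "transp2 M = (\<chi> r c. M $ (fst r, snd c) $ (fst c, snd r))"

definition smat :: "'k::field \<Rightarrow> 'k^'m::finite^'m \<Rightarrow> 'k^'m^'m" where
  "smat c M = map_matrix ((*) c) M"

definition Rmat :: "'k::field \<Rightarrow> 'k \<Rightarrow> 'k \<Rightarrow> 'k^('n \<times> 'n)^('n::{finite,linorder} \<times> 'n)" where
  "Rmat lam mu q =
     smat ((lam - mu) / (inverse q * lam - q * mu))
       (\<Sum>(i, j)\<in>{(i, j). i \<noteq> j}. mat_unit i i \<otimes>\<^sub>m mat_unit j j)
   + (\<Sum>i\<in>UNIV. mat_unit i i \<otimes>\<^sub>m mat_unit i i)
   + smat ((inverse q - q) * lam / (inverse q * lam - q * mu))
       (\<Sum>(i, j)\<in>{(i, j). i < j}. mat_unit i j \<otimes>\<^sub>m mat_unit j i)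
   + smat ((inverse q - q) * mu / (inverse q * lam - q * mu))
       (\<Sum>(i, j)\<in>{(i, j). i > j}. mat_unit i j \<otimes>\<^sub>m mat_unit j i)"

text \<open>
  The relations are identities between rational functions of the spectral parameters; they are
  imposed and asserted where no R-matrix built from \<open>lam\<close>, \<open>mu\<close>, their inverses and
  \<open>q\<close> or \<open>q\<close> inverse has a vanishing denominator, that is, where \<open>q\<^sup>2\<close> is none of
  \<open>lam/mu\<close>, \<open>mu/lam\<close>, \<open>lam mu\<close>, \<open>1/(lam mu)\<close>.
\<close>

definition generic :: "'k::field \<Rightarrow> 'k \<Rightarrow> 'k \<Rightarrow> bool" where
  "generic q lam mu \<longleftrightarrow> lam \<noteq> 0 \<and> mu \<noteq> 0 \<and>
     (\<forall>x\<in>{lam, inverse lam}. \<forall>y\<in>{mu, inverse mu}. inverse q * x - q * y \<noteq> 0)"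

text \<open>
  The two sides of each relation, for arbitrary matrices \<open>X\<close> (in space 1) and \<open>Y\<close> (in space 2)
  over a ring in which scalars are interpreted by \<open>h\<close>. In the \<open>_fwd\<close> side the entries of
  \<open>X\<close> precede those of \<open>Y\<close>, in the \<open>_rev\<close> side they follow them.
\<close>

definition AA_fwd ::
  "('k::field \<Rightarrow> 'r::ring_1) \<Rightarrow> 'k \<Rightarrow> 'k \<Rightarrow> 'k \<Rightarrow>
     'r^('n::{finite,linorder})^('n::{finite,linorder}) \<Rightarrow> 'r^('n::{finite,linorder})^('n::{finite,linorder}) \<Rightarrow>
     'r^('n \<times> 'n)^('n \<times> 'n)" where
  "AA_fwd h q lam mu X Y =
     map_matrix h (Rmat lam mu q) ** space1 X
       ** map_matrix h (transp1 (Rmat (inverse lam) mu q)) ** space2 Y"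

definition AA_rev ::
  "('k::field \<Rightarrow> 'r::ring_1) \<Rightarrow> 'k \<Rightarrow> 'k \<Rightarrow> 'k \<Rightarrow>
     'r^('n::{finite,linorder})^('n::{finite,linorder}) \<Rightarrow> 'r^('n::{finite,linorder})^('n::{finite,linorder}) \<Rightarrow>
     'r^('n \<times> 'n)^('n \<times> 'n)" where
  "AA_rev h q lam mu X Y =
     space2 Y ** map_matrix h (transp1 (Rmat (inverse lam) mu q))
       ** space1 X ** map_matrix h (Rmat lam mu q)"

definition BB_fwd ::
  "('k::field \<Rightarrow> 'r::ring_1) \<Rightarrow> 'k \<Rightarrow> 'k \<Rightarrow> 'k \<Rightarrow>
     'r^('n::{finite,linorder})^('n::{finite,linorder}) \<Rightarrow> 'r^('n::{finite,linorder})^('n::{finite,linorder}) \<Rightarrow>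
     'r^('n \<times> 'n)^('n \<times> 'n)" where
  "BB_fwd h q lam mu X Y = map_matrix h (Rmat lam mu q) ** space1 X ** space2 Y"

definition BB_rev ::
  "('k::field \<Rightarrow> 'r::ring_1) \<Rightarrow> 'k \<Rightarrow> 'k \<Rightarrow> 'k \<Rightarrow>
     'r^('n::{finite,linorder})^('n::{finite,linorder}) \<Rightarrow> 'r^('n::{finite,linorder})^('n::{finite,linorder}) \<Rightarrow>
     'r^('n \<times> 'n)^('n \<times> 'n)" where
  "BB_rev h q lam mu X Y = space2 Y ** space1 X ** map_matrix h (Rmat lam mu q)"

definition BA_fwd ::
  "('k::field \<Rightarrow> 'r::ring_1) \<Rightarrow> 'k \<Rightarrow> 'k \<Rightarrow> 'k \<Rightarrow>
     'r^('n::{finite,linorder})^('n::{finite,linorder}) \<Rightarrow> 'r^('n::{finite,linorder})^('n::{finite,linorder}) \<Rightarrow>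
     'r^('n \<times> 'n)^('n \<times> 'n)" where
  "BA_fwd h q lam mu X Y =
     space1 X ** map_matrix h (transp2 (Rmat mu (inverse lam) (inverse q))) ** space2 Y"

definition BA_rev ::
  "('k::field \<Rightarrow> 'r::ring_1) \<Rightarrow> 'k \<Rightarrow> 'k \<Rightarrow> 'k \<Rightarrow>
     'r^('n::{finite,linorder})^('n::{finite,linorder}) \<Rightarrow> 'r^('n::{finite,linorder})^('n::{finite,linorder}) \<Rightarrow>
     'r^('n \<times> 'n)^('n \<times> 'n)" where
  "BA_rev h q lam mu X Y = space2 Y ** space1 X ** map_matrix h (Rmat lam mu q)"

text \<open>
  The value at \<open>lam\<close> of the generating series with coefficient matrices \<open>a 0, a 1, ...\<close>
  is the sum of \<open>lam^(-k) a k\<close>. The product \<open>B(lam) A(lam) B\<^sup>T(lam^(-1))\<close> mixes series in opposite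
  powers of \<open>lam\<close>, whose formal coefficients would be infinite sums, so the series are summed in a
  Hausdorff topological ring at the parameters under consideration. The discrete topology gives
  the purely algebraic case of polynomials in \<open>lam^(-1)\<close>.
\<close>

definition gen_summable ::
  "('k::field \<Rightarrow> 'a::{ring_1,t2_space}) \<Rightarrow> (nat \<Rightarrow> 'a^'n::finite^'n) \<Rightarrow> 'k \<Rightarrow> bool" where
  "gen_summable h a lam \<longleftrightarrow> (\<forall>i j. summable (\<lambda>k. h (inverse lam ^ k) * a k $ i $ j))"

definition gen_mat ::
  "('k::field \<Rightarrow> 'a::{ring_1,t2_space}) \<Rightarrow> (nat \<Rightarrow> 'a^'n::finite^'n) \<Rightarrow> 'k \<Rightarrow> 'a^'n^'n" where
  "gen_mat h a lam = (\<chi> i j. \<Sum>k. h (inverse lam ^ k) * a k $ i $ j)"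

text \<open>
  Jacobi relations. The entries of a product of formal matrices \<open>X Y\<close> are independent words, so
  an array \<open>T\<close> with \<open>T (i, j) (k, l)\<close> standing for \<open>X_ij Y_kl\<close> is arbitrary (the image of the
  words under a linear functional). \<open>extend F T\<close> is the bilinear expression \<open>F X Y\<close> evaluated
  with each product \<open>X_ij Y_kl\<close>, or \<open>Y_kl X_ij\<close>, replaced by the corresponding entry of \<open>T\<close>.
  \<open>exchange q P Q lam mu T U\<close> says that the defining relation between the matrices \<open>P(lam)\<close> and
  \<open>Q(mu)\<close> holds when \<open>T\<close> is substituted for the words with \<open>P\<close> first and \<open>U\<close> for those with
  \<open>Q\<close> first. For the order A, B this is the B-A relation with the two spaces exchanged.
  Arguments of an array are always listed by space, independently of the order of the words.
\<close>

datatype letter = MatA | MatB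

definition extend ::
  "('k::field^'n::finite^'n \<Rightarrow> 'k^'n^'n \<Rightarrow> 'k^('n \<times> 'n)^('n \<times> 'n)) \<Rightarrow> ('n \<times> 'n \<Rightarrow> 'n \<times> 'n \<Rightarrow> 'k)
     \<Rightarrow> 'k^('n \<times> 'n)^('n \<times> 'n)" where
  "extend F T = (\<Sum>x\<in>UNIV. \<Sum>y\<in>UNIV.
     smat (T x y) (F (mat_unit (fst x) (snd x)) (mat_unit (fst y) (snd y))))"

fun exchange :: "'k::field \<Rightarrow> letter \<Rightarrow> letter \<Rightarrow> 'k \<Rightarrow> 'k \<Rightarrow>
    ('n::{finite,linorder} \<times> 'n \<Rightarrow> 'n \<times> 'n \<Rightarrow> 'k) \<Rightarrow> ('n \<times> 'n \<Rightarrow> 'n \<times> 'n \<Rightarrow> 'k) \<Rightarrow> bool" where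
  "exchange q MatA MatA lam mu T U \<longleftrightarrow> extend (AA_fwd id q lam mu) T = extend (AA_rev id q lam mu) U"
| "exchange q MatB MatB lam mu T U \<longleftrightarrow> extend (BB_fwd id q lam mu) T = extend (BB_rev id q lam mu) U"
| "exchange q MatB MatA lam mu T U \<longleftrightarrow> extend (BA_fwd id q lam mu) T = extend (BA_rev id q lam mu) U"
| "exchange q MatA MatB lam mu T U \<longleftrightarrow>
     extend (BA_fwd id q mu lam) (\<lambda>y x. U x y) = extend (BA_rev id q mu lam) (\<lambda>y x. T x y)"

text \<open>
  The two ways \<open>123 \<rightarrow> 213 \<rightarrow> 231 \<rightarrow> 321\<close> and \<open>123 \<rightarrow> 132 \<rightarrow> 312 \<rightarrow> 321\<close> of reversing a product of
  \<open>P(l1)\<close>, \<open>Q(l2)\<close>, \<open>S(l3)\<close> in spaces 1, 2, 3.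
\<close>

definition reverse_left ::
  "'k::field \<Rightarrow> letter \<Rightarrow> letter \<Rightarrow> letter \<Rightarrow> 'k \<Rightarrow> 'k \<Rightarrow> 'k \<Rightarrow>
     ('n::{finite,linorder} \<times> 'n \<Rightarrow> 'n \<times> 'n \<Rightarrow> 'n \<times> 'n \<Rightarrow> 'k) \<Rightarrow>
     ('n \<times> 'n \<Rightarrow> 'n \<times> 'n \<Rightarrow> 'n \<times> 'n \<Rightarrow> 'k) \<Rightarrow> bool" where
  "reverse_left q P Q S l1 l2 l3 T U \<longleftrightarrow> (\<exists>V W.
     (\<forall>z. exchange q P Q l1 l2 (\<lambda>x y. T x y z) (\<lambda>x y. V x y z)) \<and>
     (\<forall>y. exchange q P S l1 l3 (\<lambda>x z. V x y z) (\<lambda>x z. W x y z)) \<and>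
     (\<forall>x. exchange q Q S l2 l3 (\<lambda>y z. W x y z) (\<lambda>y z. U x y z)))"

definition reverse_right ::
  "'k::field \<Rightarrow> letter \<Rightarrow> letter \<Rightarrow> letter \<Rightarrow> 'k \<Rightarrow> 'k \<Rightarrow> 'k \<Rightarrow>
     ('n::{finite,linorder} \<times> 'n \<Rightarrow> 'n \<times> 'n \<Rightarrow> 'n \<times> 'n \<Rightarrow> 'k) \<Rightarrow>
     ('n \<times> 'n \<Rightarrow> 'n \<times> 'n \<Rightarrow> 'n \<times> 'n \<Rightarrow> 'k) \<Rightarrow> bool" where
  "reverse_right q P Q S l1 l2 l3 T U \<longleftrightarrow> (\<exists>V W.
     (\<forall>x. exchange q Q S l2 l3 (\<lambda>y z. T x y z) (\<lambda>y z. V x y z)) \<and>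
     (\<forall>y. exchange q P S l1 l3 (\<lambda>x z. V x y z) (\<lambda>x z. W x y z)) \<and>
     (\<forall>z. exchange q P Q l1 l2 (\<lambda>x y. W x y z) (\<lambda>x y. U x y z)))"

text \<open>
  Both ways lead from any given product to exactly one result, and the results agree.
\<close>

definition jacobi_consistent ::
  "'n::{finite,linorder} itself \<Rightarrow> 'k::field \<Rightarrow> letter \<Rightarrow> letter \<Rightarrow> letter \<Rightarrow> 'k \<Rightarrow> 'k \<Rightarrow> 'k \<Rightarrow> bool" where
  "jacobi_consistent TYPE('n) q P Q S l1 l2 l3 \<longleftrightarrow>
     (\<forall>T :: 'n \<times> 'n \<Rightarrow> 'n \<times> 'n \<Rightarrow> 'n \<times> 'n \<Rightarrow> 'k. \<exists>U. \<forall>U'.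
        (reverse_left q P Q S l1 l2 l3 T U' \<longleftrightarrow> U' = U) \<and>
        (reverse_right q P Q S l1 l2 l3 T U' \<longleftrightarrow> U' = U))"

end

theory Submission
  imports Defs
begin

text \<open>
  Regard a matrix in a classical space as a vector with a row index and a column index. The row line
  of \<open>A(\<lambda>)\<close> and of \<open>B(\<lambda>)\<close> carries the spectral parameter \<open>\<lambda>\<close>, the column line \<open>1/\<lambda>\<close>. All
  lines get the same colour, except that the row line of \<open>B\<close> gets another one. Solving any of the defining
  relations for the reordered words then says: let the two lines of the first letter cross the two lines
  of the second, each crossing being the R-matrix if the colours agree and the identity otherwise. The
  Jacobi relations become the Yang-Baxter equation for six lines.

  For the automorphism write \<open>R = R\<^sub>1\<^sub>2(\<lambda>,\<mu>)\<close> and \<open>N = R\<^sub>1\<^sub>2\<^sup>t\<^sup>1(1/\<lambda>,\<mu>)\<close>, let \<open>A\<^sub>i\<close>, \<open>B\<^sub>i\<close> be taken at \<open>\<lambda>\<close>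
  for \<open>i = 1\<close> and at \<open>\<mu>\<close> for \<open>i = 2\<close>, and \<open>C\<^sub>i\<close> the transpose of \<open>B\<close> at the inverse parameter. Partial
  transposition and exchange of the spaces turn the defining relations into exchange rules between \<open>A\<^sub>i\<close>, \<open>B\<^sub>i\<close>
  and \<open>C\<^sub>i\<close> involving only \<open>R\<close> and \<open>N\<close>; since \<open>R\<close> and \<open>N\<close> commute, both sides of the claim become
  \<open>B\<^sub>2 B\<^sub>1 N A\<^sub>2 N A\<^sub>1 N C\<^sub>2 C\<^sub>1 R\<close>.
\<close>

subsection \<open>The R-matrix\<close>

text \<open>The coefficient of \<open>E_ii \<otimes> E_jj\<close> in the R-matrix;
  \<open>swap_weight\<close> below is that of \<open>E_ij \<otimes> E_ji\<close>. The terms with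
  equal indices are counted here, so a row of the R-matrix has at most two nonzero entries.\<close>

definition diag_weight :: "'k::field \<Rightarrow> 'k \<Rightarrow> 'k \<Rightarrow> 'n \<Rightarrow> 'n \<Rightarrow> 'k" where
  "diag_weight x y q i j = (if i = j then 1 else (x - y) / (inverse q * x - q * y))"

definition swap_weight :: "'k::field \<Rightarrow> 'k \<Rightarrow> 'k \<Rightarrow> 'n::linorder \<Rightarrow> 'n \<Rightarrow> 'k" where
  "swap_weight x y q i j = (if i = j then 0
     else if i < j then (inverse q - q) * x / (inverse q * x - q * y)
     else (inverse q - q) * y / (inverse q * x - q * y))"

lemma mat_unit_nth: "mat_unit i j $ k $ l = (if k = i \<and> l = j then 1 else 0)"
  by (auto simp: mat_unit_def axis_def)

lemma kron_nth: "(X \<otimes>\<^sub>m Y) $ (i, j) $ (k, l) = X $ i $ k * Y $ j $ l"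
  by (simp add: kron_def)

lemma sum_mat_unit_diag:
  "(\<Sum>(i, j)\<in>S. mat_unit i i \<otimes>\<^sub>m mat_unit j j) $ (i', j') $ (k, l) =
     (if (i', j') \<in> S \<and> k = i' \<and> l = j' then 1 else (0 :: 'k :: ring_1))"
  for S :: "('n::finite \<times> 'n) set"
proof -
  have "(\<Sum>(i, j)\<in>S. mat_unit i i \<otimes>\<^sub>m mat_unit j j) $ (i', j') $ (k, l) =
      (\<Sum>p\<in>S. if p = (i', j') then (if k = i' \<and> l = j' then 1 else 0) else 0)"
    unfolding sum_component
    by (rule sum.cong) (auto simp: kron_nth mat_unit_nth split: prod.splits)
  also have "\<dots> = (if (i', j') \<in> S \<and> k = i' \<and> l = j' then 1 else 0)"
    by (simp add: sum.delta)
  finally show ?thesis .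
qed

lemma sum_mat_unit_swap:
  "(\<Sum>(i, j)\<in>S. mat_unit i j \<otimes>\<^sub>m mat_unit j i) $ (i', j') $ (k, l) =
     (if (i', j') \<in> S \<and> k = j' \<and> l = i' then 1 else (0 :: 'k :: ring_1))"
  for S :: "('n::finite \<times> 'n) set"
proof -
  have "(\<Sum>(i, j)\<in>S. mat_unit i j \<otimes>\<^sub>m mat_unit j i) $ (i', j') $ (k, l) =
      (\<Sum>p\<in>S. if p = (i', j') then (if k = j' \<and> l = i' then 1 else 0) else 0)"
    unfolding sum_component
    by (rule sum.cong) (auto simp: kron_nth mat_unit_nth split: prod.splits)
  also have "\<dots> = (if (i', j') \<in> S \<and> k = j' \<and> l = i' then 1 else 0)"
    by (simp add: sum.delta)
  finally show ?thesis .
qed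

lemma smat_nth: "smat c M $ r $ s = c * M $ r $ s"
  by (simp add: smat_def map_matrix_def)

lemma Rmat_nth:
  fixes x y q :: "'k::field" and i j k l :: "'n::{finite,linorder}"
  shows "Rmat x y q $ (i, j) $ (k, l) = (if k = i \<and> l = j then diag_weight x y q i j else 0)
     + (if k = j \<and> l = i then swap_weight x y q i j else 0)"
proof -
  \<comment> \<open>Rewritten as a sum over pairs, so that \<open>sum_mat_unit_diag\<close> covers
    it too.\<close>
  have diag: "(\<Sum>i\<in>UNIV. mat_unit i i \<otimes>\<^sub>m mat_unit i i :: 'k^('n \<times> 'n)^('n \<times> 'n))
      = (\<Sum>(i, j)\<in>{(i, j). i = j}. mat_unit i i \<otimes>\<^sub>m mat_unit j j)"
    by (rule sum.reindex_bij_witness[of _ fst "\<lambda>i. (i, i)"]) auto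
  have split: "c1 * (if (i, j) \<in> {(i, j). i \<noteq> j} \<and> k = i \<and> l = j then 1 else 0)
      + (if (i, j) \<in> {(i, j). i = j} \<and> k = i \<and> l = j then 1 else 0)
      + c2 * (if (i, j) \<in> {(i, j). i < j} \<and> k = j \<and> l = i then 1 else 0)
      + c3 * (if (i, j) \<in> {(i, j). i > j} \<and> k = j \<and> l = i then 1 else 0)
    = (if k = i \<and> l = j then if i = j then 1 else c1 else 0)
      + (if k = j \<and> l = i then if i = j then 0 else if i < j then c2 else c3 else 0)"
    for c1 c2 c3 :: 'k
    unfolding mem_Collect_eq prod.case
    by (cases "i = j"; cases "i < j"; cases "k = i \<and> l = j"; cases "k = j \<and> l = i")
      (simp_all only: simp_thms if_True if_False mult_zero_right mult_1_right add_0_left add_0_right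
        less_irrefl, auto)
  have "Rmat x y q $ (i, j) $ (k, l) =
    (x - y) / (inverse q * x - q * y) * (if (i, j) \<in> {(i, j). i \<noteq> j} \<and> k = i \<and> l = j then 1 else 0)
      + (if (i, j) \<in> {(i, j). i = j} \<and> k = i \<and> l = j then 1 else 0)
      + (inverse q - q) * x / (inverse q * x - q * y) * (if (i, j) \<in> {(i, j). i < j} \<and> k = j \<and> l = i then 1 else 0)
      + (inverse q - q) * y / (inverse q * x - q * y) * (if (i, j) \<in> {(i, j). i > j} \<and> k = j \<and> l = i then 1 else 0)"
    unfolding Rmat_def diag
    by (simp only: vector_add_component sum_mat_unit_diag sum_mat_unit_swap smat_nth)
  then show ?thesis unfolding split diag_weight_def swap_weight_def .
qed

lemma sum_UNIV_prod: "(\<Sum>p\<in>UNIV. f p) = (\<Sum>i\<in>UNIV. \<Sum>j\<in>UNIV. f (i, j))"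
  for f :: "'m::finite \<times> 'n::finite \<Rightarrow> 'a::comm_monoid_add"
  unfolding sum.cartesian_product UNIV_Times_UNIV by simp

lemma sum_delta_pair:
  "(\<Sum>m\<in>UNIV. \<Sum>n\<in>UNIV. if m = i \<and> n = j then f m n else 0) = f i j"
  for f :: "'m::finite \<Rightarrow> 'n::finite \<Rightarrow> 'a::comm_monoid_add"
proof -
  have "(\<Sum>m\<in>UNIV. \<Sum>n\<in>UNIV. if m = i \<and> n = j then f m n else 0)
      = (\<Sum>m\<in>UNIV. if m = i then \<Sum>n\<in>UNIV. if n = j then f m n else 0 else 0)"
    by (intro sum.cong) auto
  then show ?thesis by simp
qed

lemma sum_Rmat_row:
  "(\<Sum>m\<in>UNIV. \<Sum>n\<in>UNIV. Rmat x y q $ (i, j) $ (m, n) * f m n)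
     = diag_weight x y q i j * f i j + swap_weight x y q i j * f j i"
proof -
  have "Rmat x y q $ (i, j) $ (m, n) * f m n =
     (if m = i \<and> n = j then diag_weight x y q i j * f m n else 0)
   + (if m = j \<and> n = i then swap_weight x y q i j * f m n else 0)" for m n
    unfolding Rmat_nth distrib_right by (rule arg_cong2[of _ _ _ _ plus]) auto
  then show ?thesis by (simp only: sum.distrib sum_delta_pair)
qed

section \<open>Symmetries of the R-matrix\<close>

text \<open>Exchanging \<open>x\<close> with \<open>y\<close> and \<open>q\<close> with
  \<open>inverse q\<close> changes the sign of the common denominator and of the factors
  \<open>x - y\<close> and \<open>inverse q - q\<close>. The remaining factor \<open>x\<close> or
  \<open>y\<close> is accounted for by exchanging the indices.\<close>

lemma weights_inverse_parameter:
  "diag_weight y x (inverse q) i j = diag_weight x y q i j"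
  "swap_weight y x (inverse q) i j = swap_weight x y q j i"
proof -
  have den: "q * y - inverse q * x = - (inverse q * x - q * y)" by simp
  have num: "y - x = - (x - y)" "q - inverse q = - (inverse q - q)" by simp_all
  show "diag_weight y x (inverse q) i j = diag_weight x y q i j"
    unfolding diag_weight_def inverse_inverse_eq den num(1) minus_divide_divide by (rule refl)
  show "swap_weight y x (inverse q) i j = swap_weight x y q j i"
    unfolding swap_weight_def inverse_inverse_eq den num(2) mult_minus_left minus_divide_divide
    by (cases "i = j"; cases "i < j"; cases "j < i"; simp)
qed

lemma Rmat_transpose:
  "transpose (Rmat x y q) = (Rmat y x (inverse q) :: 'k::field^('n::{finite,linorder} \<times> 'n)^('n \<times> 'n))"
proof -
  have "Rmat x y q $ (k, l) $ (i, j) = Rmat y x (inverse q) $ (i, j) $ (k, l)" for i j k l :: 'n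
    unfolding Rmat_nth weights_inverse_parameter
    by (rule arg_cong2[of _ _ _ _ plus]) (auto simp: diag_weight_def)
  then show ?thesis by (simp add: transpose_def vec_eq_iff)
qed

text \<open>Conjugation by the permutation of the two tensor factors.\<close>

definition swap_spaces :: "'r^('n::finite \<times> 'n)^('n \<times> 'n) \<Rightarrow> 'r^('n \<times> 'n)^('n \<times> 'n)" where
  "swap_spaces M = (\<chi> r c. M $ (snd r, fst r) $ (snd c, fst c))"

lemma Rmat_swap_spaces:
  "swap_spaces (Rmat x y q) = (Rmat y x (inverse q) :: 'k::field^('n::{finite,linorder} \<times> 'n)^('n \<times> 'n))"
proof -
  have "Rmat x y q $ (j, i) $ (l, k) = Rmat y x (inverse q) $ (i, j) $ (k, l)" for i j k l :: 'n
    unfolding Rmat_nth weights_inverse_parameter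
    by (rule arg_cong2[of _ _ _ _ plus]) (auto simp: diag_weight_def)
  then show ?thesis by (simp add: swap_spaces_def vec_eq_iff)
qed

text \<open>Numerators and denominator all acquire the same factor \<open>inverse (x * y)\<close>.
  This is the source of the two equivalent forms of the B-A relation.\<close>

lemma weights_inverse_arguments:
  assumes "x \<noteq> 0" "y \<noteq> 0"
  shows "diag_weight (inverse y) (inverse x) q i j = diag_weight x y q i j"
    and "swap_weight (inverse y) (inverse x) q i j = swap_weight x y q i j"
proof -
  have den: "inverse q * inverse y - q * inverse x = (inverse q * x - q * y) * inverse (x * y)"
    and num: "inverse y - inverse x = (x - y) * inverse (x * y)"
      "(inverse q - q) * inverse y = (inverse q - q) * x * inverse (x * y)"
      "(inverse q - q) * inverse x = (inverse q - q) * y * inverse (x * y)"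
    using assms by (simp_all add: field_simps)
  have "inverse (x * y) \<noteq> 0" using assms by simp
  note cancel = mult_divide_mult_cancel_right[OF this]
  show "diag_weight (inverse y) (inverse x) q i j = diag_weight x y q i j"
    "swap_weight (inverse y) (inverse x) q i j = swap_weight x y q i j"
    unfolding diag_weight_def swap_weight_def den num(1)
    by (simp_all only: cancel num(2,3))
qed

lemma Rmat_inverse_arguments:
  assumes "x \<noteq> 0" "y \<noteq> 0"
  shows "Rmat (inverse y) (inverse x) q = Rmat x y q"
  by (simp only: vec_eq_iff split_paired_All Rmat_nth weights_inverse_arguments[OF assms] simp_thms)

section \<open>Unitarity of the R-matrix\<close>

text \<open>The R-matrix applied to \<open>f\<close> as a vector in the tensor square. In this form
  it can act on any two indices of a larger tensor.\<close>

definition Ract :: "'k::field \<Rightarrow> 'k \<Rightarrow> 'k \<Rightarrow> ('n::linorder \<Rightarrow> 'n \<Rightarrow> 'k) \<Rightarrow> 'n \<Rightarrow> 'n \<Rightarrow> 'k" where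
  "Ract x y q f i j = diag_weight x y q i j * f i j + swap_weight x y q i j * f j i"

text \<open>For \<open>i \<noteq> j\<close> both operators preserve the span of
  \<open>e_i \<otimes> e_j\<close> and \<open>e_j \<otimes> e_i\<close>, so the claim is about a
  product of two 2 by 2 blocks.\<close>

lemma Ract_inverse:
  fixes f :: "'n::linorder \<Rightarrow> 'n \<Rightarrow> 'k::field"
  assumes "inverse q * x - q * y \<noteq> 0" "inverse q * y - q * x \<noteq> 0"
  shows "Ract x y q (Ract x y (inverse q) f) = f"
proof (intro ext)
  fix i j :: 'n
  define p where "p = inverse q"
  define d where "d = p * x - q * y"
  define d' where "d' = q * x - p * y"
  have ip: "inverse p = q" by (simp add: p_def)
  have "q \<noteq> 0" using assms(1) by auto
  then have pq: "p * q = 1" by (simp add: p_def)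
  have "d \<noteq> 0" "d' \<noteq> 0"
    using assms by (auto simp: d_def d'_def p_def)
  then have nz: "d * d' \<noteq> 0" by simp
  \<comment> \<open>The entries of the product of the blocks. With \<open>p\<close> for
    \<open>inverse q\<close> and denominators cleared they are polynomial identities modulo
    \<open>p * q = 1\<close>.\<close>
  have eqs: "(x - y) / d * ((x - y) / d') + (p - q) * x / d * ((q - p) * y / d') = 1"
      "(x - y) / d * ((x - y) / d') + (p - q) * y / d * ((q - p) * x / d') = 1"
      "(x - y) / d * ((q - p) * x / d') + (p - q) * x / d * ((x - y) / d') = 0"
      "(x - y) / d * ((q - p) * y / d') + (p - q) * y / d * ((x - y) / d') = 0"
    unfolding times_divide_times_eq add_divide_distrib[symmetric] divide_eq_0_iff divide_eq_1_iff
  proof -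
    have "(x - y) * (x - y) + (p - q) * x * ((q - p) * y) = d * d'"
      "(x - y) * (x - y) + (p - q) * y * ((q - p) * x) = d * d'"
      "(x - y) * ((q - p) * x) + (p - q) * x * (x - y) = 0"
      "(x - y) * ((q - p) * y) + (p - q) * y * (x - y) = 0"
      unfolding d_def d'_def using pq by algebra+
    then show "d * d' \<noteq> 0 \<and> (x - y) * (x - y) + (p - q) * x * ((q - p) * y) = d * d'"
      "d * d' \<noteq> 0 \<and> (x - y) * (x - y) + (p - q) * y * ((q - p) * x) = d * d'"
      "(x - y) * ((q - p) * x) + (p - q) * x * (x - y) = 0 \<or> d * d' = 0"
      "(x - y) * ((q - p) * y) + (p - q) * y * (x - y) = 0 \<or> d * d' = 0"
      using nz by blast+
  qed
  consider "i = j" | "i \<noteq> j" "i < j" "\<not> j < i" | "i \<noteq> j" "\<not> i < j" "j < i"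
    by (cases i j rule: linorder_cases) auto
  then show "Ract x y q (Ract x y (inverse q) f) i j = f i j"
  proof cases
    case 1
    then show ?thesis by (simp add: Ract_def diag_weight_def swap_weight_def)
  next
    case 2
    have "Ract x y q (Ract x y (inverse q) f) i j =
      ((x - y) / d * ((x - y) / d') + (p - q) * x / d * ((q - p) * y / d')) * f i j
     + ((x - y) / d * ((q - p) * x / d') + (p - q) * x / d * ((x - y) / d')) * f j i"
      unfolding Ract_def diag_weight_def swap_weight_def if_P[OF 2(2)] if_not_P[OF 2(1)]
        if_not_P[OF 2(1)[symmetric]] if_not_P[OF 2(3)] p_def[symmetric] ip
        d_def[symmetric] d'_def[symmetric]
      by algebra
    then show ?thesis unfolding eqs by simp
  next
    case 3
    have "Ract x y q (Ract x y (inverse q) f) i j =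
      ((x - y) / d * ((x - y) / d') + (p - q) * y / d * ((q - p) * x / d')) * f i j
     + ((x - y) / d * ((q - p) * y / d') + (p - q) * y / d * ((x - y) / d')) * f j i"
      unfolding Ract_def diag_weight_def swap_weight_def if_P[OF 3(3)] if_not_P[OF 3(1)]
        if_not_P[OF 3(1)[symmetric]] if_not_P[OF 3(2)] p_def[symmetric] ip
        d_def[symmetric] d'_def[symmetric]
      by algebra
    then show ?thesis unfolding eqs by simp
  qed
qed

section \<open>The Yang-Baxter equation\<close>

text \<open>
  The weights are cleared of denominators and of \<open>inverse q\<close>, so that the Yang-Baxter equation is a
  polynomial identity without side relations.
\<close>

lemma yang_baxter_polynomial:
  fixes q x y z :: "'k::comm_ring_1" and i j k :: "'n::linorder" and f :: "'n \<Rightarrow> 'n \<Rightarrow> 'n \<Rightarrow> 'k"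
  defines "D \<equiv> \<lambda>x y (i :: 'n) j. if i = j then x - q * q * y else q * (x - y)"
    and "S \<equiv> \<lambda>x y (i :: 'n) j. if i = j then 0 else if i < j then (1 - q * q) * x else (1 - q * q) * y"
  defines "K12 \<equiv> \<lambda>f i j k. D x y i j * f i j k + S x y i j * f j i k"
    and "K13 \<equiv> \<lambda>f i j k. D x z i k * f i j k + S x z i k * f k j i"
    and "K23 \<equiv> \<lambda>f i j k. D y z j k * f i j k + S y z j k * f i k j"
  shows "K23 (K13 (K12 f)) i j k = K12 (K13 (K23 f)) i j k"
proof -
  have eq: "D u v i i = u - q * q * v" "S u v i i = 0" for u v i
    by (simp_all add: D_def S_def)
  have lt: "D u v i j = q * (u - v)" "D u v j i = q * (u - v)"
    "S u v i j = (1 - q * q) * u" "S u v j i = (1 - q * q) * v"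
    if "i < j" for u v i j
    using that less_imp_neq[OF that] less_not_sym[OF that] by (simp_all add: D_def S_def)
  \<comment> \<open>The thirteen weak orderings of three indices. In each of them \<open>eq\<close>
    and \<open>lt\<close> make every weight an explicit polynomial, and expanding both sides
    finishes the case.\<close>
  have trip: "i = j \<and> j = k \<or> i = j \<and> j < k \<or> i = j \<and> k < j \<or> i = k \<and> j < k \<or> i = k \<and> k < j
    \<or> j = k \<and> i < k \<or> j = k \<and> k < i \<or> i < j \<and> j < k \<and> i < k \<or> i < k \<and> k < j \<and> i < j
    \<or> j < i \<and> i < k \<and> j < k \<or> j < k \<and> k < i \<and> j < i \<or> k < i \<and> i < j \<and> k < j
    \<or> k < j \<and> j < i \<and> k < i"
    by (metis linorder_neqE less_trans)
  show ?thesis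
    unfolding K12_def K13_def K23_def
    by (insert trip, elim disjE conjE; simp only: eq lt;
      simp only: algebra_simps mult_zero_left mult_zero_right mult_1_left mult_1_right add_0_left add_0_right diff_0_right)
qed

text \<open>Multiplying the denominator by \<open>q\<close> gives \<open>x - q * q * y\<close>;
  splitting off its inverse leaves the weights of \<open>yang_baxter_polynomial\<close>.\<close>

lemma diag_weight_eq:
  assumes "inverse q * x - q * y \<noteq> 0"
  shows "diag_weight x y q i j
    = (if i = j then x - q * q * y else q * (x - y)) * inverse (x - q * q * y)"
proof -
  have q: "q \<noteq> 0" using assms by auto
  have den: "x - q * q * y = q * (inverse q * x - q * y)"
    using q by (simp add: right_diff_distrib mult.assoc[symmetric])
  then have "x - q * q * y \<noteq> 0" using assms q by simp
  then have "(x - q * q * y) * inverse (x - q * q * y) = 1" by (rule right_inverse)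
  moreover have "(x - y) / (inverse q * x - q * y) = q * (x - y) * inverse (x - q * q * y)"
    unfolding den divide_inverse[symmetric] mult_divide_mult_cancel_left[OF q] by (rule refl)
  ultimately show ?thesis by (simp only: diag_weight_def split: if_split) blast
qed

lemma swap_weight_eq:
  fixes x y q :: "'k::field" and i j :: "'n::linorder"
  assumes "inverse q * x - q * y \<noteq> 0"
  shows "swap_weight x y q i j
    = (if i = j then 0 else if i < j then (1 - q * q) * x else (1 - q * q) * y) * inverse (x - q * q * y)"
proof -
  have q: "q \<noteq> 0" using assms by auto
  have den: "x - q * q * y = q * (inverse q * x - q * y)"
    using q by (simp add: right_diff_distrib mult.assoc[symmetric])
  have num: "1 - q * q = q * (inverse q - q)"
    using q by (simp add: right_diff_distrib)
  have "(inverse q - q) * z / (inverse q * x - q * y) = (1 - q * q) * z * inverse (x - q * q * y)" for z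
    unfolding den num mult.assoc[of q "inverse q - q"] divide_inverse[symmetric] mult_divide_mult_cancel_left[OF q] by (rule refl)
  then show ?thesis unfolding swap_weight_def by (simp only: mult_zero_left if_distribR split: if_split) blast
qed

lemma yang_baxter_weights:
  fixes q x y z :: "'k::field" and i j k :: "'n::linorder" and f :: "'n \<Rightarrow> 'n \<Rightarrow> 'n \<Rightarrow> 'k"
  assumes "inverse q * x - q * y \<noteq> 0" "inverse q * x - q * z \<noteq> 0" "inverse q * y - q * z \<noteq> 0"
  defines "K12 \<equiv> \<lambda>f i j k. diag_weight x y q i j * f i j k + swap_weight x y q i j * f j i k"
    and "K13 \<equiv> \<lambda>f i j k. diag_weight x z q i k * f i j k + swap_weight x z q i k * f k j i"
    and "K23 \<equiv> \<lambda>f i j k. diag_weight y z q j k * f i j k + swap_weight y z q j k * f i k j"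
  shows "K23 (K13 (K12 f)) i j k = K12 (K13 (K23 f)) i j k"
proof -
  \<comment> \<open>Each side applies each of the three crossings once, so the same product of
    inverse denominators factors out of both.\<close>
  define c where "c = inverse (x - q * q * y) * inverse (x - q * q * z) * inverse (y - q * q * z)"
  define D where "D = (\<lambda>x y (i :: 'n) j. if i = j then x - q * q * y else q * (x - y))"
  define S where "S = (\<lambda>x y (i :: 'n) j. if i = j then 0 else if i < j then (1 - q * q) * x else (1 - q * q) * y)"
  define L12 where "L12 = (\<lambda>(f :: 'n \<Rightarrow> 'n \<Rightarrow> 'n \<Rightarrow> 'k) i j k. D x y i j * f i j k + S x y i j * f j i k)"
  define L13 where "L13 = (\<lambda>(f :: 'n \<Rightarrow> 'n \<Rightarrow> 'n \<Rightarrow> 'k) i j k. D x z i k * f i j k + S x z i k * f k j i)"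
  define L23 where "L23 = (\<lambda>(f :: 'n \<Rightarrow> 'n \<Rightarrow> 'n \<Rightarrow> 'k) i j k. D y z j k * f i j k + S y z j k * f i k j)"
  have D: "diag_weight u v q i j = D u v i j * inverse (u - q * q * v)"
    and S: "swap_weight u v q i j = S u v i j * inverse (u - q * q * v)"
    if "inverse q * u - q * v \<noteq> 0" for u v i j
    unfolding D_def S_def using that by (rule diag_weight_eq swap_weight_eq)+
  have "K23 (K13 (K12 f)) i j k = c * L23 (L13 (L12 f)) i j k"
    unfolding K12_def K13_def K23_def L12_def L13_def L23_def c_def D[OF assms(1)] D[OF assms(2)]
      D[OF assms(3)] S[OF assms(1)] S[OF assms(2)] S[OF assms(3)]
    by (simp only: ring_distribs mult_ac add_ac)
  also have "L23 (L13 (L12 f)) i j k = L12 (L13 (L23 f)) i j k"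
    unfolding L12_def L13_def L23_def D_def S_def by (rule yang_baxter_polynomial)
  also have "c * \<dots> = K12 (K13 (K23 f)) i j k"
    unfolding K12_def K13_def K23_def L12_def L13_def L23_def c_def D[OF assms(1)] D[OF assms(2)]
      D[OF assms(3)] S[OF assms(1)] S[OF assms(2)] S[OF assms(3)]
    by (simp only: ring_distribs mult_ac add_ac)
  finally show ?thesis .
qed

text \<open>
  A tensor in any number of factors is a function of the assignment \<open>w\<close> of an index to each factor.
  \<open>l p\<close> is the spectral parameter and \<open>col p\<close> the colour of factor \<open>p\<close>.
\<close>

definition cross :: "'k::field \<Rightarrow> (nat \<Rightarrow> 'k) \<Rightarrow> (nat \<Rightarrow> bool) \<Rightarrow> nat \<Rightarrow> nat \<Rightarrow>
    ((nat \<Rightarrow> 'n::linorder) \<Rightarrow> 'k) \<Rightarrow> (nat \<Rightarrow> 'n) \<Rightarrow> 'k" where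
  "cross q l col p r f w = (if col p = col r
     then diag_weight (l p) (l r) q (w p) (w r) * f w
        + swap_weight (l p) (l r) q (w p) (w r) * f (w(p := w r, r := w p))
     else f w)"

lemma cross_commute:
  fixes f :: "(nat \<Rightarrow> 'n::linorder) \<Rightarrow> 'k::field"
  assumes "p \<noteq> s" "p \<noteq> t" "r \<noteq> s" "r \<noteq> t"
  shows "cross q l col p r (cross q l col s t f) = cross q l col s t (cross q l col p r f)"
proof
  fix w :: "nat \<Rightarrow> 'n"
  have upd: "w(p := a, r := b, s := c, t := d) = w(s := c, t := d, p := a, r := b)" for a b c d
    using assms by (auto simp: fun_eq_iff)
  show "cross q l col p r (cross q l col s t f) w = cross q l col s t (cross q l col p r f) w"
    using assms by (auto simp only: cross_def fun_upd_apply upd ring_distribs mult_ac add_ac simp_thms if_True if_False split: if_split)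
qed

lemma cross_yang_baxter:
  fixes f :: "(nat \<Rightarrow> 'n::linorder) \<Rightarrow> 'k::field"
  assumes "p \<noteq> r" "p \<noteq> s" "r \<noteq> s"
    and "inverse q * l p - q * l r \<noteq> 0" "inverse q * l p - q * l s \<noteq> 0" "inverse q * l r - q * l s \<noteq> 0"
  shows "cross q l col r s (cross q l col p s (cross q l col p r f))
    = cross q l col p r (cross q l col p s (cross q l col r s f))"
proof
  fix w :: "nat \<Rightarrow> 'n"
  \<comment> \<open>Only three factors are involved: \<open>G\<close> freezes the other indices at
    their values in \<open>w\<close>.\<close>
  define G where "G f a b c = f (w(p := a, r := b, s := c))" for f :: "(nat \<Rightarrow> 'n) \<Rightarrow> 'k" and a b c
  have upd: "w(p := a, r := b, s := c, p := b, r := a) = w(p := b, r := a, s := c)"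
    "w(p := a, r := b, s := c, p := c, s := a) = w(p := c, r := b, s := a)"
    "w(p := a, r := b, s := c, r := c, s := b) = w(p := a, r := c, s := b)" for a b c
    using assms(1-3) by (auto simp: fun_eq_iff)
  have at: "(w(p := a, r := b, s := c)) p = a" "(w(p := a, r := b, s := c)) r = b"
    "(w(p := a, r := b, s := c)) s = c" for a b c
    using assms(1-3) by auto
  have G12: "G (cross q l col p r f) = (\<lambda>a b c. if col p = col r
      then diag_weight (l p) (l r) q a b * G f a b c + swap_weight (l p) (l r) q a b * G f b a c else G f a b c)" for f
    by (intro ext) (simp only: G_def cross_def at upd)
  have G13: "G (cross q l col p s f) = (\<lambda>a b c. if col p = col s
      then diag_weight (l p) (l s) q a c * G f a b c + swap_weight (l p) (l s) q a c * G f c b a else G f a b c)" for f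
    by (intro ext) (simp only: G_def cross_def at upd)
  have G23: "G (cross q l col r s f) = (\<lambda>a b c. if col r = col s
      then diag_weight (l r) (l s) q b c * G f a b c + swap_weight (l r) (l s) q b c * G f a c b else G f a b c)" for f
    by (intro ext) (simp only: G_def cross_def at upd)
  have "G (cross q l col r s (cross q l col p s (cross q l col p r f))) a b c
    = G (cross q l col p r (cross q l col p s (cross q l col r s f))) a b c" for a b c
  proof (cases "col p = col r \<and> col p = col s")
    case True
    then have "col p = col r" "col p = col s" "col r = col s" by auto
    show ?thesis
      unfolding G12 G13 G23 if_P[OF \<open>col p = col r\<close>] if_P[OF \<open>col p = col s\<close>] if_P[OF \<open>col r = col s\<close>]
      by (rule yang_baxter_weights[OF assms(4-6)])
  next
    case False
    \<comment> \<open>If the three colours are not all equal, at least two of the three pairs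
      differ. Both sides then reduce to the same single crossing, or to no crossing.\<close>
    then consider "col p \<noteq> col r" "col p \<noteq> col s" | "col p \<noteq> col r" "col r \<noteq> col s"
      | "col p \<noteq> col s" "col r \<noteq> col s" by blast
    then show ?thesis
      unfolding G12 G13 G23 by cases (simp_all only: if_False)
  qed
  from this[of "w p" "w r" "w s"]
  show "cross q l col r s (cross q l col p s (cross q l col p r f)) w
    = cross q l col p r (cross q l col p s (cross q l col r s f)) w"
    by (simp add: G_def)
qed

text \<open>The lines start in the order \<open>p, p', r, r'\<close>. The neighbours
  \<open>p'\<close> and \<open>r\<close> cross first, and \<open>p\<close> and \<open>r'\<close>
  cross last.\<close>

definition cross_block :: "'k::field \<Rightarrow> (nat \<Rightarrow> 'k) \<Rightarrow> (nat \<Rightarrow> bool) \<Rightarrow> nat \<Rightarrow> nat \<Rightarrow> nat \<Rightarrow> nat \<Rightarrow>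
    ((nat \<Rightarrow> 'n::linorder) \<Rightarrow> 'k) \<Rightarrow> (nat \<Rightarrow> 'n) \<Rightarrow> 'k" where
  "cross_block q l col p p' r r' f =
     cross q l col p r' (cross q l col p' r' (cross q l col p r (cross q l col p' r f)))"

lemma cross_block_yang_baxter:
  fixes f :: "(nat \<Rightarrow> 'n::linorder) \<Rightarrow> 'k::field" and col :: "nat \<Rightarrow> bool"
  assumes den: "\<And>p r. p \<in> {0, 1} \<Longrightarrow> r \<in> {2, 3, 4, 5} \<Longrightarrow> inverse q * l p - q * l r \<noteq> 0"
    "\<And>p r. p \<in> {2, 3} \<Longrightarrow> r \<in> {4, 5} \<Longrightarrow> inverse q * l p - q * l r \<noteq> 0"
  defines "X \<equiv> cross_block q l col"
  shows "X 2 3 4 5 (X 0 1 4 5 (X 0 1 2 3 f)) = X 0 1 2 3 (X 0 1 4 5 (X 2 3 4 5 f))"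
proof -
  note One_nat_def [simp del]
  define K :: "nat \<Rightarrow> nat \<Rightarrow> ((nat \<Rightarrow> 'n) \<Rightarrow> 'k) \<Rightarrow> (nat \<Rightarrow> 'n) \<Rightarrow> 'k" where "K = cross q l col"
  \<comment> \<open>Line \<open>p\<close> passes both lines of the third letter.\<close>
  define Z where "Z p f = K p 5 (K p 4 f)" for p and f :: "(nat \<Rightarrow> 'n) \<Rightarrow> 'k"
  have comm: "K p r (K s t f) = K s t (K p r f)"
    if "{p, r} \<inter> {s, t} = {}" for p r s t f
    unfolding K_def using that by (intro cross_commute) auto
  \<comment> \<open>Two applications of the Yang-Baxter equation, to the lines \<open>p\<close>,
    \<open>r\<close>, 4 and to \<open>p\<close>, \<open>r\<close>, 5, with commutations of disjoint
    crossings in between.\<close>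
  have pass: "Z r (Z p (K p r f)) = K p r (Z p (Z r f))" if "p \<in> {0, 1}" "r \<in> {2, 3}" for p r f
  proof -
    have ne: "p \<noteq> r" "p \<noteq> 4" "p \<noteq> 5" "r \<noteq> 4" "r \<noteq> 5" using that by auto
    have yb: "K r s (K p s (K p r g)) = K p r (K p s (K r s g))" if "s \<in> {4, 5}" for s g
      unfolding K_def using \<open>p \<in> {0, 1}\<close> \<open>r \<in> {2, 3}\<close> that ne
      by (intro cross_yang_baxter den) auto
    have "Z r (Z p (K p r f)) = K r 5 (K p 5 (K r 4 (K p 4 (K p r f))))"
      unfolding Z_def using ne by (simp add: comm[of r 4 p 5])
    also have "\<dots> = K r 5 (K p 5 (K p r (K p 4 (K r 4 f))))"
      by (simp add: yb)
    also have "\<dots> = K p r (K p 5 (K r 5 (K p 4 (K r 4 f))))"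
      by (simp add: yb)
    also have "\<dots> = K p r (Z p (Z r f))"
      unfolding Z_def using ne by (simp add: comm[of r 5 p 4])
    finally show ?thesis .
  qed
  have Zcomm: "Z s (K p r f) = K p r (Z s f)" if "s \<notin> {p, r}" "p \<notin> {4, 5}" "r \<notin> {4, 5}" for p r s f
    unfolding Z_def using that by (simp add: comm[of s _ p r])
  have X12: "X 0 1 2 3 f = K 0 3 (K 0 2 (K 1 3 (K 1 2 f)))" for f
    unfolding X_def cross_block_def K_def[symmetric] by (simp add: comm[of 1 3 0 2])
  have X13: "X 0 1 4 5 f = Z 0 (Z 1 f)" and X23: "X 2 3 4 5 f = Z 2 (Z 3 f)" for f
    unfolding X_def cross_block_def K_def[symmetric] Z_def
    by (simp_all add: comm[of 1 5 0 4] comm[of 3 5 2 4])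
  have "X 2 3 4 5 (X 0 1 4 5 (X 0 1 2 3 f)) = Z 2 (Z 3 (Z 0 (K 0 3 (K 0 2 (Z 1 (K 1 3 (K 1 2 f)))))))"
    unfolding X12 X13 X23 by (simp add: Zcomm[of 1])
  \<comment> \<open>The crossing of 0 and 3 is moved out first; those of 0 with 2 and 1 with 3
    follow, and 1 with 2 comes last.\<close>
  also have "\<dots> = K 0 3 (Z 2 (Z 0 (K 0 2 (Z 3 (Z 1 (K 1 3 (K 1 2 f)))))))"
    by (simp add: pass[of 0 3] Zcomm[of 3 0 2] Zcomm[of 2 0 3])
  also have "\<dots> = K 0 3 (K 0 2 (Z 0 (K 1 3 (Z 2 (Z 1 (K 1 2 (Z 3 f)))))))"
    by (simp add: pass[of 0 2] pass[of 1 3] Zcomm[of 3 1 2] Zcomm[of 2 1 3])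
  also have "\<dots> = X 0 1 2 3 (X 0 1 4 5 (X 2 3 4 5 f))"
    unfolding X12 X13 X23 by (simp add: pass[of 1 2] Zcomm[of 0])
  finally show ?thesis .
qed

section \<open>Entries of products of operators in the two spaces\<close>

lemma space_mult_nth:
  "(M ** space1 X) $ r $ (k, l) = (\<Sum>m\<in>UNIV. M $ r $ (m, l) * X $ m $ k)"
  "(M ** space2 X) $ r $ (k, l) = (\<Sum>m\<in>UNIV. M $ r $ (k, m) * X $ m $ l)"
  "(space1 X ** M) $ (i, j) $ c = (\<Sum>m\<in>UNIV. X $ i $ m * M $ (m, j) $ c)"
  "(space2 X ** M) $ (i, j) $ c = (\<Sum>m\<in>UNIV. X $ j $ m * M $ (i, m) $ c)"
  for X :: "'r::ring_1^'n::finite^'n"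
proof -
  have delta: "z * (x * (if a = b then 1 else 0)) = (if a = b then z * x else 0)"
    "z * ((if a = b then 1 else 0) * x) = (if a = b then z * x else 0)"
    "(x * (if a = b then 1 else 0)) * z = (if a = b then x * z else 0)"
    "((if a = b then 1 else 0) * x) * z = (if a = b then x * z else 0)" for x z :: 'r and a b :: 'n
    by simp_all
  show "(M ** space1 X) $ r $ (k, l) = (\<Sum>m\<in>UNIV. M $ r $ (m, l) * X $ m $ k)"
    "(M ** space2 X) $ r $ (k, l) = (\<Sum>m\<in>UNIV. M $ r $ (k, m) * X $ m $ l)"
    "(space1 X ** M) $ (i, j) $ c = (\<Sum>m\<in>UNIV. X $ i $ m * M $ (m, j) $ c)"
    "(space2 X ** M) $ (i, j) $ c = (\<Sum>m\<in>UNIV. X $ j $ m * M $ (i, m) $ c)"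
    unfolding space1_def space2_def matrix_matrix_mult_def
    by (simp_all add: kron_nth sum_UNIV_prod mat_def delta sum.delta if_distrib if_distribR cong: if_cong)
      (subst sum.swap, simp add: delta)+
qed

lemma space_products_nth:
  fixes X Y :: "'r::ring_1^'n::finite^'n"
  shows "(space1 X ** N ** space2 Y) $ (i, j) $ (k, l) =
      (\<Sum>b\<in>UNIV. (\<Sum>a\<in>UNIV. X $ i $ a * N $ (a, j) $ (k, b)) * Y $ b $ l)"
    "(space2 Y ** N ** space1 X) $ (i, j) $ (k, l) =
      (\<Sum>a\<in>UNIV. (\<Sum>b\<in>UNIV. Y $ j $ b * N $ (i, b) $ (a, l)) * X $ a $ k)"
    by (simp_all only: space_mult_nth)

subsection \<open>Jacobi relations\<close>

lemma smat_matrix_mult: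
  "smat c (M ** N) = M ** smat c N" "smat c (M ** N) = smat c M ** N"
  by (simp_all add: vec_eq_iff smat_nth matrix_matrix_mult_def sum_distrib_left mult_ac)

lemma sum_matrix_mult:
  "M ** (\<Sum>x\<in>S. F x) = (\<Sum>x\<in>S. M ** F x)" "(\<Sum>x\<in>S. F x) ** M = (\<Sum>x\<in>S. F x ** M)"
  for M :: "'k::semiring_1^'m::finite^'m"
  by (simp_all add: vec_eq_iff matrix_matrix_mult_def sum_component sum_distrib_left sum_distrib_right
      sum.swap[of _ S])

lemma extend_mult:
  "extend (\<lambda>X Y. M ** F X Y) T = M ** extend F T"
  "extend (\<lambda>X Y. F X Y ** M) T = extend F T ** M"
proof -
  show "extend (\<lambda>X Y. M ** F X Y) T = M ** extend F T"
    by (simp only: extend_def smat_matrix_mult(1) sum_matrix_mult)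
  show "extend (\<lambda>X Y. F X Y ** M) T = extend F T ** M"
    by (simp only: extend_def smat_matrix_mult(2) sum_matrix_mult)
qed

lemma extend_nth:
  "extend F T $ r $ c = (\<Sum>x1\<in>UNIV. \<Sum>x2\<in>UNIV. \<Sum>y1\<in>UNIV. \<Sum>y2\<in>UNIV.
     T (x1, x2) (y1, y2) * F (mat_unit x1 x2) (mat_unit y1 y2) $ r $ c)"
  by (simp only: extend_def sum_component smat_nth sum_UNIV_prod fst_conv snd_conv)

lemma sum_delta_middle:
  fixes f :: "'n::finite \<Rightarrow> 'k::semiring_1"
  shows "(\<Sum>a\<in>UNIV. (if i = c \<and> a = d then 1 else 0) * f a) = (if i = c then f d else 0)"
    "(\<Sum>a\<in>UNIV. f a * (if a = c \<and> j = d then 1 else 0)) = (if j = d then f c else 0)"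
  by (cases "i = c"; cases "j = d"; simp add: if_distrib if_distribR sum.delta cong: if_cong)+

lemma sum_if_eq:
  fixes f :: "'n::finite \<Rightarrow> 'k::semiring_1"
  shows "(\<Sum>a\<in>UNIV. if a = c then f a else 0) = f c"
    "(\<Sum>a\<in>UNIV. if c = a then f a else 0) = f c"
  by simp_all

text \<open>An entry of such a product is bilinear in the entries of \<open>X\<close> and
  \<open>Y\<close>. Evaluation at matrix units reads off its coefficients, and \<open>T\<close>
  replaces the products of entries.\<close>

lemma extend_products_nth:
  fixes T :: "'n::{finite,linorder} \<times> 'n \<Rightarrow> 'n \<times> 'n \<Rightarrow> 'k::field"
  shows "extend (\<lambda>X Y. space1 X ** N ** space2 Y) T $ (i, j) $ (k, l)
      = (\<Sum>a\<in>UNIV. \<Sum>b\<in>UNIV. N $ (a, j) $ (k, b) * T (i, a) (b, l))" (is ?A)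
    and "extend (\<lambda>X Y. space2 Y ** N ** space1 X) T $ (i, j) $ (k, l)
      = (\<Sum>a\<in>UNIV. \<Sum>b\<in>UNIV. N $ (i, b) $ (a, l) * T (a, k) (j, b))" (is ?B)
    and "extend (\<lambda>X Y. space1 X ** space2 Y) T $ (i, j) $ (k, l) = T (i, k) (j, l)" (is ?C)
    and "extend (\<lambda>X Y. space2 Y ** space1 X) T $ (i, j) $ (k, l) = T (i, k) (j, l)" (is ?D)
proof -
  have pull: "t * (if a = b then z else 0) = (if a = b then t * z else 0)"
    "(\<Sum>y\<in>UNIV. if a = b then g y else 0) = (if a = b then \<Sum>y\<in>UNIV. g y else 0)"
    "(if a = b then z else 0) * t = (if a = b then z * t else 0)"
    for t z :: 'k and a b :: 'n and g :: "'n \<Rightarrow> 'k"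
    by simp_all
  show ?A
    unfolding extend_nth space_products_nth mat_unit_nth sum_delta_middle
    by (simp only: pull sum_if_eq mult.commute)
  show ?B
    unfolding extend_nth space_products_nth mat_unit_nth sum_delta_middle
    by (simp only: pull sum_if_eq mult.commute)
  have products: "(space1 X ** space2 Y) $ (i, j) $ (k, l) = X $ i $ k * Y $ j $ l"
    "(space2 Y ** space1 X) $ (i, j) $ (k, l) = Y $ j $ l * X $ i $ k"
    for X Y :: "'k^('n::{finite,linorder})^('n::{finite,linorder})"
    unfolding space_mult_nth unfolding space1_def space2_def kron_nth mat_def
    by (simp_all add: if_distrib if_distribR sum.delta cong: if_cong)
  have unit: "t * ((if i = c \<and> k = d then 1 else 0) * (if j = a \<and> l = b then 1 else 0))
      = (if i = c then if k = d then if j = a then if l = b then t else 0 else 0 else 0 else 0)"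
    "t * ((if j = a \<and> l = b then 1 else 0) * (if i = c \<and> k = d then 1 else 0))
      = (if i = c then if k = d then if j = a then if l = b then t else 0 else 0 else 0 else 0)"
    for t :: 'k and a b c d by simp_all
  show ?C ?D
    unfolding extend_nth products mat_unit_nth unit
    by (simp_all only: pull sum_if_eq)
qed

text \<open>Multiplication from the right acts on the pair of column indices by the transpose, which
  is the R-matrix with exchanged arguments and inverted \<open>q\<close>.\<close>

lemma Rmat_mult_nth:
  "(Rmat x y q ** M) $ (i, j) $ c = Ract x y q (\<lambda>i j. M $ (i, j) $ c) i j"
  "(M ** Rmat x y q) $ r $ (k, l) = Ract y x (inverse q) (\<lambda>k l. M $ r $ (k, l)) k l"
proof -
  show "(Rmat x y q ** M) $ (i, j) $ c = Ract x y q (\<lambda>i j. M $ (i, j) $ c) i j"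
    by (simp add: matrix_matrix_mult_def sum_UNIV_prod sum_Rmat_row Ract_def)
  have "(M ** Rmat x y q) $ r $ (k, l)
      = (\<Sum>m\<in>UNIV. \<Sum>n\<in>UNIV. transpose (Rmat x y q) $ (k, l) $ (m, n) * M $ r $ (m, n))"
    by (simp add: matrix_matrix_mult_def sum_UNIV_prod transpose_def mult.commute)
  then show "(M ** Rmat x y q) $ r $ (k, l) = Ract y x (inverse q) (\<lambda>k l. M $ r $ (k, l)) k l"
    by (simp add: Rmat_transpose sum_Rmat_row Ract_def)
qed

lemma sum_Rmat_column:
  fixes f :: "'n::{finite,linorder} \<Rightarrow> 'n \<Rightarrow> 'k::field"
  shows "(\<Sum>m\<in>UNIV. \<Sum>n\<in>UNIV. Rmat x y q $ (m, n) $ (i, j) * f m n) = Ract y x (inverse q) f i j"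
proof -
  have "Rmat x y q $ (m, n) $ (i, j) = Rmat y x (inverse q) $ (i, j) $ (m, n)" for m n i j :: 'n
    unfolding Rmat_transpose[symmetric] by (simp add: transpose_def)
  then show ?thesis by (simp only: sum_Rmat_row Ract_def)
qed

lemma map_matrix_id: "map_matrix id M = M"
  by (simp add: map_matrix_def vec_eq_iff)

text \<open>Each R-matrix couples two of the four lines: rows \<open>i, j\<close> or columns
  \<open>k, l\<close> for the outer factor, and the column of one letter with the row of the other
  for the partially transposed factor in the middle.\<close>

lemma extend_AA:
  "extend (AA_fwd id q x y) T $ (i, j) $ (k, l)
     = Ract x y q (\<lambda>i j. Ract (inverse x) y q (\<lambda>k j. T (i, k) (j, l)) k j) i j"
  "extend (AA_rev id q x y) T $ (i, j) $ (k, l)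
     = Ract y x (inverse q) (\<lambda>k l. Ract y (inverse x) (inverse q) (\<lambda>i l. T (i, k) (j, l)) i l) k l"
proof -
  have fwd: "AA_fwd id q x y = (\<lambda>X Y. Rmat x y q **
      (space1 X ** transp1 (Rmat (inverse x) y q) ** space2 Y))"
    by (simp only: AA_fwd_def[abs_def] map_matrix_id matrix_mul_assoc)
  show "extend (AA_fwd id q x y) T $ (i, j) $ (k, l)
     = Ract x y q (\<lambda>i j. Ract (inverse x) y q (\<lambda>k j. T (i, k) (j, l)) k j) i j"
    unfolding fwd extend_mult Rmat_mult_nth extend_products_nth
    by (simp only: transp1_def vec_lambda_beta fst_conv snd_conv sum_Rmat_row Ract_def)
  have rev: "AA_rev id q x y = (\<lambda>X Y.
      (space2 Y ** transp1 (Rmat (inverse x) y q) ** space1 X) ** Rmat x y q)"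
    by (simp only: AA_rev_def[abs_def] map_matrix_id)
  show "extend (AA_rev id q x y) T $ (i, j) $ (k, l)
     = Ract y x (inverse q) (\<lambda>k l. Ract y (inverse x) (inverse q) (\<lambda>i l. T (i, k) (j, l)) i l) k l"
    unfolding rev extend_mult Rmat_mult_nth extend_products_nth
    by (simp only: transp1_def vec_lambda_beta fst_conv snd_conv sum_Rmat_column)
qed

lemma extend_BB:
  "extend (BB_fwd id q x y) T $ (i, j) $ (k, l) = Ract x y q (\<lambda>i j. T (i, k) (j, l)) i j"
  "extend (BB_rev id q x y) T $ (i, j) $ (k, l) = Ract y x (inverse q) (\<lambda>k l. T (i, k) (j, l)) k l"
proof -
  have fwd: "BB_fwd id q x y = (\<lambda>X Y. Rmat x y q ** (space1 X ** space2 Y))"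
    by (simp only: BB_fwd_def[abs_def] map_matrix_id matrix_mul_assoc)
  show "extend (BB_fwd id q x y) T $ (i, j) $ (k, l) = Ract x y q (\<lambda>i j. T (i, k) (j, l)) i j"
    unfolding fwd extend_mult Rmat_mult_nth extend_products_nth by (rule refl)
  have rev: "BB_rev id q x y = (\<lambda>X Y. (space2 Y ** space1 X) ** Rmat x y q)"
    by (simp only: BB_rev_def[abs_def] map_matrix_id)
  show "extend (BB_rev id q x y) T $ (i, j) $ (k, l) = Ract y x (inverse q) (\<lambda>k l. T (i, k) (j, l)) k l"
    unfolding rev extend_mult Rmat_mult_nth extend_products_nth by (rule refl)
qed

lemma extend_BA:
  "extend (BA_fwd id q x y) T $ (i, j) $ (k, l) = Ract (inverse x) y q (\<lambda>k j. T (i, k) (j, l)) k j"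
  "extend (BA_rev id q x y) T $ (i, j) $ (k, l) = Ract y x (inverse q) (\<lambda>k l. T (i, k) (j, l)) k l"
proof -
  have fwd: "BA_fwd id q x y = (\<lambda>X Y. space1 X ** transp2 (Rmat y (inverse x) (inverse q)) ** space2 Y)"
    by (simp only: BA_fwd_def[abs_def] map_matrix_id)
  show "extend (BA_fwd id q x y) T $ (i, j) $ (k, l) = Ract (inverse x) y q (\<lambda>k j. T (i, k) (j, l)) k j"
    unfolding fwd extend_products_nth
    by (simp only: transp2_def vec_lambda_beta fst_conv snd_conv sum_Rmat_column inverse_inverse_eq)
  have rev: "BA_rev id q x y = (\<lambda>X Y. (space2 Y ** space1 X) ** Rmat x y q)"
    by (simp only: BA_rev_def[abs_def] map_matrix_id)
  show "extend (BA_rev id q x y) T $ (i, j) $ (k, l) = Ract y x (inverse q) (\<lambda>k l. T (i, k) (j, l)) k l"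
    unfolding rev extend_mult Rmat_mult_nth extend_products_nth by (rule refl)
qed

section \<open>Solving the exchange relations for the reordered words\<close>

lemma Ract_inverse_arguments:
  fixes f :: "'n::linorder \<Rightarrow> 'n \<Rightarrow> 'k::field"
  assumes "x \<noteq> 0" "y \<noteq> 0"
  shows "Ract (inverse y) (inverse x) q f = Ract x y q f"
  by (intro ext) (simp only: Ract_def weights_inverse_arguments[OF assms])

lemma Ract_swap: "Ract y x (inverse q) (\<lambda>i j. f j i) j i = Ract x y q f i j"
  unfolding Ract_def weights_inverse_parameter by (simp only: diag_weight_def eq_commute[of j i])

lemma Ract_eq_iff:
  fixes f g :: "'n::linorder \<Rightarrow> 'n \<Rightarrow> 'k::field"
  assumes "inverse q * x - q * y \<noteq> 0" "inverse q * y - q * x \<noteq> 0"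
  shows "Ract x y (inverse q) f = g \<longleftrightarrow> f = Ract x y q g"
proof -
  have "q * x - inverse q * y \<noteq> 0" "q * y - inverse q * x \<noteq> 0"
    using assms by auto
  then have "Ract x y (inverse q) (Ract x y q g) = g"
    using Ract_inverse[of "inverse q" x y g] by simp
  with Ract_inverse[OF assms, of f] show ?thesis by metis
qed

definition braid :: "bool \<Rightarrow> 'k::field \<Rightarrow> 'k \<Rightarrow> 'k \<Rightarrow> ('n::linorder \<Rightarrow> 'n \<Rightarrow> 'k) \<Rightarrow> 'n \<Rightarrow> 'n \<Rightarrow> 'k" where
  "braid c x y q f = (if c then Ract x y q f else f)"

text \<open>The pairs \<open>i, k\<close> and \<open>j, l\<close> are the row and column lines of
  the first and second letter. The flags compare colours: a column line has the colour of the row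
  line of A, so \<open>k\<close> and \<open>l\<close> always cross, while \<open>i\<close> and
  \<open>l\<close> cross only if the first letter is A.\<close>

definition reorder :: "'k::field \<Rightarrow> letter \<Rightarrow> letter \<Rightarrow> 'k \<Rightarrow> 'k \<Rightarrow> ('n::linorder \<Rightarrow> 'n \<Rightarrow> 'n \<Rightarrow> 'n \<Rightarrow> 'k)
    \<Rightarrow> 'n \<Rightarrow> 'n \<Rightarrow> 'n \<Rightarrow> 'n \<Rightarrow> 'k" where
  "reorder q P Q x y F =
     (\<lambda>i k j l. braid (P = MatA) x (inverse y) q (\<lambda>i l.
       braid True (inverse x) (inverse y) q (\<lambda>k l.
         braid (P = Q) x y q (\<lambda>i j.
           braid (Q = MatA) (inverse x) y q (\<lambda>k j. F i k j l) k j) i j) k l) i l)"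

text \<open>\<open>generic\<close> speaks of one order of the arguments only. The reversed
  denominator is the one at the inverse arguments multiplied by \<open>u * v\<close>.\<close>

lemma generic_denominators:
  assumes "generic q x y" "u \<in> {x, inverse x}" "v \<in> {y, inverse y}"
  shows "inverse q * u - q * v \<noteq> 0" "inverse q * v - q * u \<noteq> 0"
proof -
  have nz: "x \<noteq> 0" "y \<noteq> 0" and den: "\<And>u v. u \<in> {x, inverse x} \<Longrightarrow> v \<in> {y, inverse y} \<Longrightarrow> inverse q * u - q * v \<noteq> 0"
    using assms(1) unfolding generic_def by blast+
  show "inverse q * u - q * v \<noteq> 0" using assms(2,3) by (rule den)
  have "u \<noteq> 0" "v \<noteq> 0" using nz assms(2,3) by auto
  then have "inverse u * (u * v) = v" "inverse v * (u * v) = u"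
    by (simp_all add: mult.left_commute)
  then have "inverse q * v - q * u = (inverse q * inverse u - q * inverse v) * (u * v)"
    by (simp only: left_diff_distrib mult.assoc)
  moreover have "inverse q * inverse u - q * inverse v \<noteq> 0"
    using assms(2,3) by (intro den) auto
  ultimately show "inverse q * v - q * u \<noteq> 0"
    using \<open>u \<noteq> 0\<close> \<open>v \<noteq> 0\<close> by simp
qed

text \<open>Unitarity inverts the R-matrices acting on \<open>U\<close>, and inversion of both
  arguments brings the result to the form of \<open>reorder\<close>.\<close>

lemma exchange_iff:
  fixes T U :: "'n::{finite,linorder} \<times> 'n \<Rightarrow> 'n \<times> 'n \<Rightarrow> 'k::field"
  assumes "generic q x y"
  shows "exchange q P Q x y T U \<longleftrightarrow>
    (\<forall>i k j l. U (i, k) (j, l) = reorder q P Q x y (\<lambda>i k j l. T (i, k) (j, l)) i k j l)"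
proof -
  have nz: "x \<noteq> 0" "y \<noteq> 0" using assms unfolding generic_def by blast+
  note den = generic_denominators[OF assms]
  have args: "Ract (inverse x) (inverse y) t f = Ract y x t f"
    "Ract x (inverse y) t f = Ract y (inverse x) t f" for t and f :: "'n \<Rightarrow> 'n \<Rightarrow> 'k"
    using Ract_inverse_arguments[OF nz(2,1), of t f] Ract_inverse_arguments[of y "inverse x" t f] nz
    by simp_all
  have inv: "Ract u v (inverse q) f = g \<longleftrightarrow> f = Ract u v q g"
    "Ract v u (inverse q) f = g \<longleftrightarrow> f = Ract v u q g"
    if "u \<in> {x, inverse x}" "v \<in> {y, inverse y}" for f g :: "'n \<Rightarrow> 'n \<Rightarrow> 'k" and u v
    by (rule Ract_eq_iff; rule den[OF that])+
  have inv_il: "(\<forall>i k j l. Ract y (inverse x) (inverse q) (\<lambda>i l. F i k j l) i l = G i k j l) \<longleftrightarrow>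
      (\<forall>i k j l. F i k j l = Ract y (inverse x) q (\<lambda>i l. G i k j l) i l)" for F G :: "'n \<Rightarrow> 'n \<Rightarrow> 'n \<Rightarrow> 'n \<Rightarrow> 'k"
    using inv(2)[of "inverse x" y "\<lambda>i l. F i k j l" "\<lambda>i l. G i k j l" for k j]
    unfolding fun_eq_iff by blast
  have inv_kl: "(\<forall>i k j l. Ract y x (inverse q) (\<lambda>k l. F i k j l) k l = G i k j l) \<longleftrightarrow>
      (\<forall>i k j l. F i k j l = Ract y x q (\<lambda>k l. G i k j l) k l)" for F G :: "'n \<Rightarrow> 'n \<Rightarrow> 'n \<Rightarrow> 'n \<Rightarrow> 'k"
    using inv(2)[of x y "\<lambda>k l. F i k j l" "\<lambda>k l. G i k j l" for i j]
    unfolding fun_eq_iff by blast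
  have entries: "(M = N) \<longleftrightarrow> (\<forall>i k j l. N $ (i, j) $ (k, l) = M $ (i, j) $ (k, l))"
    for M N :: "'k^('n \<times> 'n)^('n \<times> 'n)"
    by (auto simp: vec_eq_iff)
  show ?thesis
  proof (cases P; cases Q)
    assume PQ: "P = MatA" "Q = MatA"
    show ?thesis
      unfolding PQ exchange.simps entries extend_AA inv_kl inv_il
      by (simp only: reorder_def braid_def simp_thms if_True args)
  next
    assume PQ: "P = MatB" "Q = MatB"
    show ?thesis
      unfolding PQ exchange.simps entries extend_BB inv_kl
      by (simp only: reorder_def braid_def simp_thms if_True if_False args letter.distinct)
  next
    assume PQ: "P = MatB" "Q = MatA"
    show ?thesis
      unfolding PQ exchange.simps entries extend_BA inv_kl
      by (simp only: reorder_def braid_def simp_thms if_True if_False args letter.distinct)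
  next
    assume PQ: "P = MatA" "Q = MatB"
    \<comment> \<open>The relation is used here with the two spaces exchanged.
      \<open>Ract_swap\<close> restores the order of the two indices in each crossing.\<close>
    have swapped: "Ract x y (inverse q) (\<lambda>l k. T (i, k) (j, l)) l k = Ract y x q (\<lambda>k l. T (i, k) (j, l)) k l"
      "Ract (inverse y) x q (\<lambda>l i. U (i, k) (j, l)) l i
        = Ract y (inverse x) (inverse q) (\<lambda>i l. U (i, k) (j, l)) i l"
      for i j k l
      unfolding args(2)[symmetric]
      using Ract_swap[of x y q "\<lambda>k l. T (i, k) (j, l)" l k]
        Ract_swap[of "inverse y" x "inverse q" "\<lambda>i l. U (i, k) (j, l)" l i]
      by simp_all
    have permute: "(\<forall>i k j l. R j l i k) \<longleftrightarrow> (\<forall>i k j l. R i k j l)" for R :: "'n \<Rightarrow> 'n \<Rightarrow> 'n \<Rightarrow> 'n \<Rightarrow> bool"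
      by blast
    have "exchange q MatA MatB x y T U \<longleftrightarrow> (\<forall>i k j l.
        Ract x y (inverse q) (\<lambda>k l. T (j, l) (i, k)) k l = Ract (inverse y) x q (\<lambda>k j. U (j, l) (i, k)) k j)"
      unfolding exchange.simps entries extend_BA by (rule refl)
    also have "\<dots> \<longleftrightarrow> (\<forall>i k j l. Ract x y (inverse q) (\<lambda>l k. T (i, k) (j, l)) l k
        = Ract (inverse y) x q (\<lambda>l i. U (i, k) (j, l)) l i)"
      by (rule permute[of "\<lambda>i k j l. Ract x y (inverse q) (\<lambda>l k. T (i, k) (j, l)) l k
        = Ract (inverse y) x q (\<lambda>l i. U (i, k) (j, l)) l i"])
    also have "\<dots> \<longleftrightarrow> (\<forall>i k j l. Ract y (inverse x) (inverse q) (\<lambda>i l. U (i, k) (j, l)) i l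
        = Ract y x q (\<lambda>k l. T (i, k) (j, l)) k l)"
      unfolding swapped by (simp only: eq_commute)
    finally show ?thesis
      unfolding PQ inv_il
      by (simp only: reorder_def braid_def simp_thms if_True if_False args letter.distinct)
  qed
qed

text \<open>The link between lines and letters: each of the four crossings becomes one
  \<open>braid\<close> factor, acting on the four indices with all others frozen.\<close>

lemma cross_block_reorder:
  fixes f :: "(nat \<Rightarrow> 'n::linorder) \<Rightarrow> 'k::field" and w :: "nat \<Rightarrow> 'n"
  assumes "distinct [p, p', r, r']"
    and "l p' = inverse (l p)" "l r' = inverse (l r)"
    and "col p \<longleftrightarrow> P = MatA" "col p'" "col r \<longleftrightarrow> Q = MatA" "col r'"
  shows "cross_block q l col p p' r r' f w
    = reorder q P Q (l p) (l r) (\<lambda>i k j m. f (w(p := i, p' := k, r := j, r' := m))) (w p) (w p') (w r) (w r')"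
proof -
  define G where "G f i k j m = f (w(p := i, p' := k, r := j, r' := m))" for f :: "(nat \<Rightarrow> 'n) \<Rightarrow> 'k" and i k j m
  have ne: "p \<noteq> p'" "p \<noteq> r" "p \<noteq> r'" "p' \<noteq> r" "p' \<noteq> r'" "r \<noteq> r'"
    using assms(1) by auto
  have upd: "w(p := i, p' := k, r := j, r' := m, p' := j, r := k) = w(p := i, p' := j, r := k, r' := m)"
    "w(p := i, p' := k, r := j, r' := m, p := j, r := i) = w(p := j, p' := k, r := i, r' := m)"
    "w(p := i, p' := k, r := j, r' := m, p' := m, r' := k) = w(p := i, p' := m, r := j, r' := k)"
    "w(p := i, p' := k, r := j, r' := m, p := m, r' := i) = w(p := m, p' := k, r := j, r' := i)" for i k j m
    using ne by (auto simp: fun_eq_iff)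
  have at: "(w(p := i, p' := k, r := j, r' := m)) p = i" "(w(p := i, p' := k, r := j, r' := m)) p' = k"
    "(w(p := i, p' := k, r := j, r' := m)) r = j" "(w(p := i, p' := k, r := j, r' := m)) r' = m" for i k j m
    using ne by auto
  have same: "(P = Q) = (col p = col r)" using assms(4,6) by (cases P; cases Q) simp_all
  have G: "G (cross q l col p' r f) = (\<lambda>i k j m. braid (Q = MatA) (inverse (l p)) (l r) q (\<lambda>k j. G f i k j m) k j)"
    "G (cross q l col p r f) = (\<lambda>i k j m. braid (P = Q) (l p) (l r) q (\<lambda>i j. G f i k j m) i j)"
    "G (cross q l col p' r' f) = (\<lambda>i k j m. braid True (inverse (l p)) (inverse (l r)) q (\<lambda>k m. G f i k j m) k m)"
    "G (cross q l col p r' f) = (\<lambda>i k j m. braid (P = MatA) (l p) (inverse (l r)) q (\<lambda>i m. G f i k j m) i m)" for f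
    unfolding assms(2,3)[symmetric] assms(4,6)[symmetric] same
    by (intro ext, simp only: G_def cross_def at upd braid_def Ract_def assms(5,7) simp_thms split: if_split, blast?)+
  have "G (cross_block q l col p p' r r' f) = reorder q P Q (l p) (l r) (G f)"
    unfolding cross_block_def G reorder_def by (rule refl)
  then have "G (cross_block q l col p p' r r' f) (w p) (w p') (w r) (w r')
      = reorder q P Q (l p) (l r) (G f) (w p) (w p') (w r) (w r')" by (rule arg_cong)
  then show ?thesis by (simp add: G_def[abs_def])
qed

section \<open>Consistency of the two reversals\<close>

definition word_value :: "('n \<times> 'n \<Rightarrow> 'n \<times> 'n \<Rightarrow> 'n \<times> 'n \<Rightarrow> 'k) \<Rightarrow> (nat \<Rightarrow> 'n) \<Rightarrow> 'k" where
  "word_value T w = T (w 0, w 1) (w 2, w 3) (w 4, w 5)"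

lemma word_value_eq_iff: "word_value V = F \<longleftrightarrow> (\<forall>w. V (w 0, w 1) (w 2, w 3) (w 4, w 5) = F w)"
  by (simp add: fun_eq_iff word_value_def)

lemma all_words_iff:
  "(\<forall>w :: nat \<Rightarrow> 'n. R (w 0) (w 1) (w 2) (w 3) (w 4) (w 5)) \<longleftrightarrow> (\<forall>i k j l m n. R i k j l m n)"
proof (intro iffI allI)
  fix i k j l m n
  assume *: "\<forall>w :: nat \<Rightarrow> 'n. R (w 0) (w 1) (w 2) (w 3) (w 4) (w 5)"
  show "R i k j l m n"
    using *[rule_format, of "\<lambda>p. [i, k, j, l, m, n] ! p"] by simp
qed simp

lemma word_value_inject: "word_value T = word_value U \<longleftrightarrow> T = U"
  unfolding word_value_eq_iff unfolding word_value_def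
  unfolding all_words_iff[of "\<lambda>i k j l m n. T (i, k) (j, l) (m, n) = U (i, k) (j, l) (m, n)"]
  by (auto simp: fun_eq_iff)

lemma exchange_ex:
  assumes "generic q x y"
  shows "\<exists>U. \<forall>z. exchange q P Q x y (T z) (U z)"
  unfolding exchange_iff[OF assms]
  by (rule exI[of _ "\<lambda>z a b. reorder q P Q x y (\<lambda>i k j l. T z (i, k) (j, l)) (fst a) (snd a) (fst b) (snd b)"]) simp

text \<open>Every exchange determines its result by a \<open>cross_block\<close>, so each reversal
  has exactly one outcome. The two outcomes are the two sides of
  \<open>cross_block_yang_baxter\<close>.\<close>

lemma jacobi_consistent:
  fixes l1 l2 l3 :: "'k::field"
  assumes gen: "generic q l1 l2" "generic q l1 l3" "generic q l2 l3"
  shows "jacobi_consistent TYPE('n::{finite,linorder}) q P Q S l1 l2 l3"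
proof -
  define l where "l = (\<lambda>p. [l1, inverse l1, l2, inverse l2, l3, inverse l3] ! p)"
  define col where "col = (\<lambda>p. [P = MatA, True, Q = MatA, True, S = MatA, True] ! p)"
  define X :: "nat \<Rightarrow> nat \<Rightarrow> nat \<Rightarrow> nat \<Rightarrow> ((nat \<Rightarrow> 'n) \<Rightarrow> 'k) \<Rightarrow> (nat \<Rightarrow> 'n) \<Rightarrow> 'k"
    where "X = cross_block q l col"
  have l: "l 0 = l1" "l 1 = inverse (l 0)" "l 2 = l2" "l 3 = inverse (l 2)" "l 4 = l3" "l 5 = inverse (l 4)"
    by (simp_all add: l_def)
  have col: "col 0 \<longleftrightarrow> P = MatA" "col 1" "col 2 \<longleftrightarrow> Q = MatA" "col 3" "col 4 \<longleftrightarrow> S = MatA" "col 5"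
    by (simp_all add: col_def)
  have X12: "(\<forall>z. exchange q P Q l1 l2 (\<lambda>x y. T x y z) (\<lambda>x y. V x y z))
      \<longleftrightarrow> word_value V = X 0 1 2 3 (word_value T)" for T V :: "'n \<times> 'n \<Rightarrow> 'n \<times> 'n \<Rightarrow> 'n \<times> 'n \<Rightarrow> 'k"
  proof -
    have "X 0 1 2 3 (word_value T) w = reorder q P Q l1 l2 (\<lambda>i k j m. T (i, k) (j, m) (w 4, w 5))
        (w 0) (w 1) (w 2) (w 3)" for w
      unfolding X_def using cross_block_reorder[of 0 1 2 3 l col P Q q "word_value T" w] l col
      by (simp add: word_value_def)
    then show ?thesis
      unfolding exchange_iff[OF gen(1)] word_value_eq_iff
      using all_words_iff[of "\<lambda>i k j l m n. V (i, k) (j, l) (m, n)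
        = reorder q P Q l1 l2 (\<lambda>i k j l. T (i, k) (j, l) (m, n)) i k j l"]
      by auto
  qed
  have X13: "(\<forall>y. exchange q P S l1 l3 (\<lambda>x z. T x y z) (\<lambda>x z. V x y z))
      \<longleftrightarrow> word_value V = X 0 1 4 5 (word_value T)" for T V :: "'n \<times> 'n \<Rightarrow> 'n \<times> 'n \<Rightarrow> 'n \<times> 'n \<Rightarrow> 'k"
  proof -
    have "X 0 1 4 5 (word_value T) w = reorder q P S l1 l3 (\<lambda>i k j m. T (i, k) (w 2, w 3) (j, m))
        (w 0) (w 1) (w 4) (w 5)" for w
      unfolding X_def using cross_block_reorder[of 0 1 4 5 l col P S q "word_value T" w] l col
      by (simp add: word_value_def)
    then show ?thesis
      unfolding exchange_iff[OF gen(2)] word_value_eq_iff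
      using all_words_iff[of "\<lambda>i k m n j l. V (i, k) (m, n) (j, l)
        = reorder q P S l1 l3 (\<lambda>i k j l. T (i, k) (m, n) (j, l)) i k j l"]
      by auto
  qed
  have X23: "(\<forall>x. exchange q Q S l2 l3 (\<lambda>y z. T x y z) (\<lambda>y z. V x y z))
      \<longleftrightarrow> word_value V = X 2 3 4 5 (word_value T)" for T V :: "'n \<times> 'n \<Rightarrow> 'n \<times> 'n \<Rightarrow> 'n \<times> 'n \<Rightarrow> 'k"
  proof -
    have "X 2 3 4 5 (word_value T) w = reorder q Q S l2 l3 (\<lambda>i k j m. T (w 0, w 1) (i, k) (j, m))
        (w 2) (w 3) (w 4) (w 5)" for w
      unfolding X_def using cross_block_reorder[of 2 3 4 5 l col Q S q "word_value T" w] l col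
      by (simp add: word_value_def)
    then show ?thesis
      unfolding exchange_iff[OF gen(3)] word_value_eq_iff
      using all_words_iff[of "\<lambda>m n i k j l. V (m, n) (i, k) (j, l)
        = reorder q Q S l2 l3 (\<lambda>i k j l. T (m, n) (i, k) (j, l)) i k j l"]
      by auto
  qed
  \<comment> \<open>A crossing applied to the tensor of an array again comes from an array, so the
    intermediate words of a reversal exist.\<close>
  have ex12: "\<exists>V. word_value V = X 0 1 2 3 (word_value T)" for T
    unfolding X12[symmetric]
  proof -
    obtain U where "\<forall>z. exchange q P Q l1 l2 (\<lambda>x y. T x y z) (U z)"
      using exchange_ex[OF gen(1), of P Q "\<lambda>z x y. T x y z"] by blast
    then show "\<exists>V. \<forall>z. exchange q P Q l1 l2 (\<lambda>x y. T x y z) (\<lambda>x y. V x y z)"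
      by (intro exI[of _ "\<lambda>x y z. U z x y"]) simp
  qed
  have ex13: "\<exists>V. word_value V = X 0 1 4 5 (word_value T)" for T
    unfolding X13[symmetric]
  proof -
    obtain U where "\<forall>y. exchange q P S l1 l3 (\<lambda>x z. T x y z) (U y)"
      using exchange_ex[OF gen(2), of P S "\<lambda>y x z. T x y z"] by blast
    then show "\<exists>V. \<forall>y. exchange q P S l1 l3 (\<lambda>x z. T x y z) (\<lambda>x z. V x y z)"
      by (intro exI[of _ "\<lambda>x y z. U y x z"]) simp
  qed
  have ex23: "\<exists>V. word_value V = X 2 3 4 5 (word_value T)" for T
    unfolding X23[symmetric]
  proof -
    obtain U where "\<forall>x. exchange q Q S l2 l3 (\<lambda>y z. T x y z) (U x)"
      using exchange_ex[OF gen(3), of Q S "\<lambda>x y z. T x y z"] by blast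
    then show "\<exists>V. \<forall>x. exchange q Q S l2 l3 (\<lambda>y z. T x y z) (\<lambda>y z. V x y z)"
      by (intro exI[of _ "\<lambda>x y z. U x y z"]) simp
  qed
  have left: "reverse_left q P Q S l1 l2 l3 T U
      \<longleftrightarrow> word_value U = X 2 3 4 5 (X 0 1 4 5 (X 0 1 2 3 (word_value T)))" for T U
    unfolding reverse_left_def X12 X13 X23 by (metis ex12 ex13)
  have right: "reverse_right q P Q S l1 l2 l3 T U
      \<longleftrightarrow> word_value U = X 0 1 2 3 (X 0 1 4 5 (X 2 3 4 5 (word_value T)))" for T U
    unfolding reverse_right_def X12 X13 X23 by (metis ex23 ex13)
  have yb: "X 2 3 4 5 (X 0 1 4 5 (X 0 1 2 3 f)) = X 0 1 2 3 (X 0 1 4 5 (X 2 3 4 5 f))" for f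
    unfolding X_def
  proof (rule cross_block_yang_baxter)
    fix p r :: nat assume "p \<in> {0, 1}" "r \<in> {2, 3, 4, 5}"
    then show "inverse q * l p - q * l r \<noteq> 0"
      using generic_denominators(1)[OF gen(1), of "l p" "l r"] generic_denominators(1)[OF gen(2), of "l p" "l r"] l
      by auto
  next
    fix p r :: nat assume "p \<in> {2, 3}" "r \<in> {4, 5}"
    then show "inverse q * l p - q * l r \<noteq> 0"
      using generic_denominators(1)[OF gen(3), of "l p" "l r"] l by auto
  qed
  show ?thesis
    unfolding jacobi_consistent_def left right yb
  proof
    fix T :: "'n \<times> 'n \<Rightarrow> 'n \<times> 'n \<Rightarrow> 'n \<times> 'n \<Rightarrow> 'k"
    obtain U where "word_value U = X 0 1 2 3 (X 0 1 4 5 (X 2 3 4 5 (word_value T)))"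
      by (metis ex12 ex13 ex23)
    then show "\<exists>U. \<forall>U'. (word_value U' = X 0 1 2 3 (X 0 1 4 5 (X 2 3 4 5 (word_value T))) \<longleftrightarrow> U' = U)
        \<and> (word_value U' = X 0 1 2 3 (X 0 1 4 5 (X 2 3 4 5 (word_value T))) \<longleftrightarrow> U' = U)"
      by (metis word_value_inject)
  qed
qed

subsection \<open>The automorphism\<close>

lemma transp1_Rmat_nth:
  "transp1 (Rmat x y q) $ (i, j) $ (k, l) = (if i = k \<and> l = j then diag_weight x y q k j else 0)
     + (if i = j \<and> l = k then swap_weight x y q k j else 0)"
  by (simp only: transp1_def vec_lambda_beta fst_conv snd_conv Rmat_nth)

text \<open>Partial transposition turns \<open>E_ij \<otimes> E_ji\<close> into
  \<open>E_ji \<otimes> E_ji\<close>, which is fixed by exchanging the spaces, and the diagonal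
  weights are symmetric.\<close>

lemma swap_spaces_transp1_Rmat:
  "swap_spaces (transp1 (Rmat x y q)) = (transp1 (Rmat x y q) :: 'k::field^('n::{finite,linorder} \<times> 'n)^('n \<times> 'n))"
proof -
  have "transp1 (Rmat x y q) $ (j, i) $ (l, k) = transp1 (Rmat x y q) $ (i, j) $ (k, l)"
    for i j k l :: 'n
    unfolding transp1_Rmat_nth
    by (rule arg_cong2[of _ _ _ _ plus]) (auto simp: diag_weight_def)
  then show ?thesis by (simp add: swap_spaces_def vec_eq_iff)
qed

text \<open>
  A product of the two swap parts vanishes on both sides, since \<open>E\<^sub>i\<^sub>j \<otimes> E\<^sub>j\<^sub>i\<close> with \<open>i \<noteq> j\<close> annihilates
  the \<open>E\<^sub>k\<^sub>l \<otimes> E\<^sub>k\<^sub>l\<close>.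
\<close>

lemma Rmat_commute_transp1:
  "Rmat x y q ** transp1 (Rmat z w q) = transp1 (Rmat z w q) ** (Rmat x y q :: 'k::field^('n::{finite,linorder} \<times> 'n)^('n \<times> 'n))"
proof -
  have zero: "transp1 (Rmat z w q) $ (i, j) $ (k, l) = 0"
    if "\<not> (i = k \<and> l = j)" "\<not> (i = j \<and> l = k)" for i j k l :: 'n
    unfolding transp1_Rmat_nth if_not_P[OF that(1)] if_not_P[OF that(2)] by (rule add_0_left)
  \<comment> \<open>\<open>diag_weight\<close> depends only on whether its indices agree, and the
    entries of the transposed R-matrix never connect an equal pair with an unequal one.\<close>
  have "diag_weight x y q i j * transp1 (Rmat z w q) $ (i, j) $ (k, l)
      = diag_weight x y q k l * transp1 (Rmat z w q) $ (i, j) $ (k, l)" for i j k l :: 'n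
  proof -
    consider "i = k" "l = j" | "i = j" "l = k" | "\<not> (i = k \<and> l = j)" "\<not> (i = j \<and> l = k)" by blast
    then show ?thesis
    proof cases
      case 3
      show ?thesis unfolding zero[OF 3] by simp
    qed (simp_all only: diag_weight_def simp_thms if_True)
  qed
  \<comment> \<open>\<open>swap_weight\<close> vanishes on equal indices, so only the diagonal part
    of the transposed R-matrix contributes, and its weights are symmetric.\<close>
  moreover have "swap_weight x y q i j * transp1 (Rmat z w q) $ (j, i) $ (k, l)
      = swap_weight x y q l k * transp1 (Rmat z w q) $ (i, j) $ (l, k)" for i j k l :: 'n
  proof -
    consider "j = k" "l = i" "i \<noteq> j" | "i = j" "l = k" | "\<not> (j = k \<and> l = i)" "\<not> (i = j \<and> l = k)" by blast
    then show ?thesis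
    proof cases
      case 1
      then have "k \<noteq> i" "i \<noteq> k" by auto
      then show ?thesis
        unfolding 1(1,2) transp1_Rmat_nth diag_weight_def by (simp only: simp_thms if_True if_False)
    next
      case 2
      then show ?thesis by (simp only: swap_weight_def simp_thms if_True mult_zero_left)
    next
      case 3
      then have "\<not> (i = l \<and> k = j)" "\<not> (i = j \<and> k = l)" "\<not> (j = i \<and> l = k)" by auto
      then show ?thesis using 3 by (simp only: zero simp_thms mult_zero_right)
    qed
  qed
  ultimately show ?thesis
    unfolding vec_eq_iff split_paired_All Rmat_mult_nth Ract_def weights_inverse_parameter
    by (intro allI arg_cong2[of _ _ _ _ plus])
qed

lemma Rmat_unitary:
  fixes q x y :: "'k::field"
  assumes "inverse q * x - q * y \<noteq> 0" "inverse q * y - q * x \<noteq> 0"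
  shows "Rmat x y q ** Rmat x y (inverse q) = (mat 1 :: 'k^('n::{finite,linorder} \<times> 'n)^('n \<times> 'n))"
proof -
  have "(Rmat x y q ** Rmat x y (inverse q)) $ (i, j) $ (k, l) = mat 1 $ (i, j) $ (k, l)" for i j k l :: 'n
  proof -
    have "(Rmat x y q ** (Rmat x y (inverse q) ** mat 1)) $ (i, j) $ (k, l) = mat 1 $ (i, j) $ (k, l)"
      unfolding Rmat_mult_nth(1) Ract_inverse[OF assms] by (rule refl)
    then show ?thesis by simp
  qed
  then show ?thesis by (simp only: vec_eq_iff split_paired_All simp_thms)
qed

lemma map_matrix_nth: "map_matrix h M $ i $ j = h (M $ i $ j)"
  by (simp add: map_matrix_def)

section \<open>Transposing products with noncommuting entries\<close>

context
  fixes h :: "'k::field \<Rightarrow> 'a::ring_1"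
  assumes h: "central_hom h"
begin

lemma central: "h c * x = x * h c"
  using h unfolding central_hom_def by blast

lemma central_hom_sum: "h (sum f S) = (\<Sum>x\<in>S. h (f x))"
proof -
  have add: "h (c + d) = h c + h d" for c d
    using h unfolding central_hom_def by blast
  then have "h 0 = 0" using add[of 0 0] by simp
  then show ?thesis
    by (induction S rule: infinite_finite_induct) (simp_all add: add)
qed

lemma map_matrix_hom:
  "map_matrix h (M ** N) = map_matrix h M ** map_matrix h N" "map_matrix h (mat 1) = mat 1"
proof -
  have mult: "h (c * d) = h c * h d" and one: "h 1 = 1" for c d
    using h unfolding central_hom_def by blast+
  show "map_matrix h (M ** N) = map_matrix h M ** map_matrix h N"
    by (simp add: vec_eq_iff map_matrix_nth matrix_matrix_mult_def central_hom_sum mult)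
  show "map_matrix h (mat 1) = mat 1"
    using central_hom_sum[of _ "{}"] by (simp add: vec_eq_iff map_matrix_nth mat_def one)
qed

text \<open>Over a noncommutative ring transposition need not reverse products. Here the scalar
  matrix moves to the other side of the factor in space 1, while the entries of \<open>X\<close> and
  \<open>Y\<close> keep their order in every word; centrality of the scalars does the rest.\<close>

lemma transp1_products:
  fixes X Y :: "'a^'n::finite^'n" and C :: "'k^('n \<times> 'n)^('n \<times> 'n)"
  shows "transp1 (map_matrix h C ** space1 X ** space2 Y)
      = space1 (transpose X) ** map_matrix h (transp1 C) ** space2 Y"
    and "transp1 (space2 Y ** space1 X ** map_matrix h C)
      = space2 Y ** map_matrix h (transp1 C) ** space1 (transpose X)"
    and "transp1 (space1 X ** map_matrix h C ** space2 Y)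
      = map_matrix h (transp1 C) ** space1 (transpose X) ** space2 Y"
proof -
  show "transp1 (map_matrix h C ** space1 X ** space2 Y)
      = space1 (transpose X) ** map_matrix h (transp1 C) ** space2 Y"
    by (simp add: vec_eq_iff space_mult_nth map_matrix_nth transp1_def transpose_def central)
  show "transp1 (space1 X ** map_matrix h C ** space2 Y)
      = map_matrix h (transp1 C) ** space1 (transpose X) ** space2 Y"
    by (simp add: vec_eq_iff space_mult_nth map_matrix_nth transp1_def transpose_def central)
  have "(\<Sum>m\<in>UNIV. Y $ j $ m * (\<Sum>a\<in>UNIV. X $ k $ a * h (C $ (a, m) $ (i, l))))
    = (\<Sum>a\<in>UNIV. (\<Sum>b\<in>UNIV. Y $ j $ b * h (C $ (a, b) $ (i, l))) * X $ k $ a)" for i j k l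
    unfolding sum_distrib_left sum_distrib_right
    by (subst sum.swap) (simp add: central mult.assoc)
  then show "transp1 (space2 Y ** space1 X ** map_matrix h C)
      = space2 Y ** map_matrix h (transp1 C) ** space1 (transpose X)"
    by (simp add: matrix_mul_assoc[of "space2 Y" "space1 X", symmetric] vec_eq_iff space_mult_nth
        map_matrix_nth transp1_def transpose_def)
qed

text \<open>The factors in spaces 1 and 2 are not reversed, since the entries of \<open>X\<close>
  and \<open>Y\<close> must keep their order; only the scalar matrix changes sides.\<close>

lemma transpose_products:
  fixes X Y :: "'a^'n::finite^'n" and C :: "'k^('n \<times> 'n)^('n \<times> 'n)"
  shows "transpose (map_matrix h C ** space1 X ** space2 Y)
      = space1 (transpose X) ** space2 (transpose Y) ** map_matrix h (transpose C)"
    and "transpose (space2 Y ** space1 X ** map_matrix h C)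
      = map_matrix h (transpose C) ** space2 (transpose Y) ** space1 (transpose X)"
proof -
  have "(\<Sum>n\<in>UNIV. (\<Sum>m\<in>UNIV. h (C $ r $ (m, n)) * X $ m $ i) * Y $ n $ j)
    = (\<Sum>a\<in>UNIV. X $ a $ i * (\<Sum>b\<in>UNIV. Y $ b $ j * h (C $ r $ (a, b))))" for i j r
    unfolding sum_distrib_left sum_distrib_right
    by (subst sum.swap) (simp add: central mult.assoc)
  then show "transpose (map_matrix h C ** space1 X ** space2 Y)
      = space1 (transpose X) ** space2 (transpose Y) ** map_matrix h (transpose C)"
    by (simp add: matrix_mul_assoc[of "space1 _" "space2 _", symmetric] vec_eq_iff space_mult_nth
        map_matrix_nth transpose_def)
  have "(\<Sum>m\<in>UNIV. Y $ l $ m * (\<Sum>a\<in>UNIV. X $ k $ a * h (C $ (a, m) $ c)))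
    = (\<Sum>a\<in>UNIV. (\<Sum>b\<in>UNIV. h (C $ (a, b) $ c) * Y $ l $ b) * X $ k $ a)" for k l c
    unfolding sum_distrib_left sum_distrib_right
    by (subst sum.swap) (simp add: central mult.assoc)
  then show "transpose (space2 Y ** space1 X ** map_matrix h C)
      = map_matrix h (transpose C) ** space2 (transpose Y) ** space1 (transpose X)"
    by (simp add: matrix_mul_assoc[of "space2 Y" "space1 X", symmetric] vec_eq_iff space_mult_nth
        map_matrix_nth transpose_def)
qed

end

lemma swap_spaces_products:
  "swap_spaces (M ** N) = swap_spaces M ** swap_spaces N"
  "swap_spaces (space1 X) = space2 X" "swap_spaces (space2 X) = space1 X"
  "swap_spaces (map_matrix h C) = map_matrix h (swap_spaces C)"
  for M N :: "'a::ring_1^('n::finite \<times> 'n)^('n \<times> 'n)"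
proof -
  have "(\<Sum>m\<in>UNIV. \<Sum>n\<in>UNIV. M $ r $ (m, n) * N $ (m, n) $ c)
    = (\<Sum>n\<in>UNIV. \<Sum>m\<in>UNIV. M $ r $ (m, n) * N $ (m, n) $ c)" for r c
    by (rule sum.swap)
  then show "swap_spaces (M ** N) = swap_spaces M ** swap_spaces N"
    by (simp add: vec_eq_iff swap_spaces_def matrix_matrix_mult_def sum_UNIV_prod)
  show "swap_spaces (space1 X) = space2 X" "swap_spaces (space2 X) = space1 X"
    "swap_spaces (map_matrix h C) = map_matrix h (swap_spaces C)"
    by (auto simp: vec_eq_iff swap_spaces_def space1_def space2_def kron_def mat_def map_matrix_nth)
qed

lemma space_matrix_mult:
  fixes X Y :: "'a::ring_1^'n::finite^'n"
  shows "space1 (X ** Y) = space1 X ** space1 Y" "space2 (X ** Y) = space2 X ** space2 Y"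
proof -
  have "space1 (X ** Y) $ (i, j) $ (k, l) = (space1 X ** space1 Y) $ (i, j) $ (k, l)" for i j k l
    unfolding space_mult_nth(3) unfolding space1_def kron_nth matrix_matrix_mult_def
    by (simp add: sum_distrib_right mult.assoc)
  then show "space1 (X ** Y) = space1 X ** space1 Y"
    by (simp only: vec_eq_iff split_paired_All simp_thms)
  have "space2 (X ** Y) $ (i, j) $ (k, l) = (space2 X ** space2 Y) $ (i, j) $ (k, l)" for i j k l
    unfolding space_mult_nth(4) unfolding space2_def kron_nth matrix_matrix_mult_def mat_def
    by (cases "i = k") simp_all
  then show "space2 (X ** Y) = space2 X ** space2 Y"
    by (simp only: vec_eq_iff split_paired_All simp_thms)
qed

section \<open>The exchange relation for the dressed matrices\<close>

text \<open>The computation needs only associativity and the exchange rules, so it is done for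
  abstract matrices. Rules with a trailing factor \<open>Z\<close> rewrite inside right-nested
  products.\<close>

lemma dressed_exchange:
  fixes R :: "'a::semiring_1^'m::finite^'m"
  assumes inv: "R ** R' = mat 1" "R' ** R = mat 1"
    and comm: "R ** N = N ** R"
    and AA: "R ** A1 ** N ** A2 = A2 ** N ** A1 ** R"
    and BB: "R ** B1 ** B2 = B2 ** B1 ** R"
    and CC: "R ** C1 ** C2 = C2 ** C1 ** R"
    and CB: "C1 ** N ** B2 = B2 ** N ** C1" "C2 ** N ** B1 = B1 ** N ** C2"
    and AB: "A1 ** B2 = B2 ** N ** A1 ** R" "A2 ** B1 ** R = B1 ** N ** A2"
    and AC: "R ** C1 ** A2 = A2 ** N ** C1" "A1 ** N ** C2 = R' ** C2 ** A1"
  shows "R ** (B1 ** A1 ** C1) ** N ** (B2 ** A2 ** C2) = B2 ** A2 ** C2 ** N ** (B1 ** A1 ** C1) ** R"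
proof -
  note assoc = matrix_mul_assoc[symmetric]
  have cancel: "R ** (R' ** Z) = Z" "R' ** (R ** Z) = Z" for Z :: "'a^'m^'m"
    by (simp_all add: matrix_mul_assoc inv)
  have comm': "R ** (N ** Z) = N ** (R ** Z)" for Z :: "'a^'m^'m"
    by (simp add: matrix_mul_assoc comm)
  have C1A2: "C1 ** (A2 ** Z) = R' ** (A2 ** (N ** (C1 ** Z)))" for Z :: "'a^'m^'m"
  proof -
    have "R' ** (R ** C1 ** A2) ** Z = R' ** (A2 ** N ** C1) ** Z" unfolding AC(1) by (rule refl)
    then show ?thesis by (simp only: assoc cancel)
  qed
  have A2B1: "A2 ** (B1 ** Z) = B1 ** (N ** (A2 ** (R' ** Z)))" for Z :: "'a^'m^'m"
  proof -
    have "(A2 ** B1 ** R) ** (R' ** Z) = (B1 ** N ** A2) ** (R' ** Z)" unfolding AB(2) by (rule refl)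
    then show ?thesis by (simp only: assoc cancel)
  qed
  have C2A1: "C2 ** (A1 ** Z) = R ** (A1 ** (N ** (C2 ** Z)))" for Z :: "'a^'m^'m"
  proof -
    have "R ** (A1 ** N ** C2) ** Z = R ** (R' ** C2 ** A1) ** Z" unfolding AC(2) by (rule refl)
    then show ?thesis by (simp only: assoc cancel)
  qed
  have assoc_rules: "C1 ** (N ** (B2 ** Z)) = B2 ** (N ** (C1 ** Z))"
    "C2 ** (N ** (B1 ** Z)) = B1 ** (N ** (C2 ** Z))"
    "A1 ** (B2 ** Z) = B2 ** (N ** (A1 ** (R ** Z)))"
    "R ** (B1 ** (B2 ** Z)) = B2 ** (B1 ** (R ** Z))"
    "R ** (A1 ** (N ** (A2 ** Z))) = A2 ** (N ** (A1 ** (R ** Z)))" for Z :: "'a^'m^'m"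
    using arg_cong[OF CB(1), of "\<lambda>M. M ** Z"] arg_cong[OF CB(2), of "\<lambda>M. M ** Z"]
      arg_cong[OF AB(1), of "\<lambda>M. M ** Z"] arg_cong[OF BB, of "\<lambda>M. M ** Z"]
      arg_cong[OF AA, of "\<lambda>M. M ** Z"]
    by (simp_all only: assoc)
  have CC': "R ** (C1 ** C2) = C2 ** (C1 ** R)" using CC by (simp only: assoc)
  \<comment> \<open>\<open>B2\<close> passes \<open>C1\<close> and \<open>A1\<close>, and
    \<open>A2\<close> passes \<open>C1\<close>; the \<open>R\<close> and \<open>R'\<close> produced
    cancel. The leading \<open>R\<close> then travels through the B, A and C pairs.\<close>
  have "R ** (B1 ** A1 ** C1) ** N ** (B2 ** A2 ** C2)
      = B2 ** (B1 ** (N ** (A2 ** (N ** (A1 ** (N ** (C2 ** (C1 ** R))))))))"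
    by (simp only: assoc assoc_rules C1A2 comm' cancel CC')
  \<comment> \<open>Read from the right: \<open>B1\<close> passes \<open>C2\<close> and
    \<open>A2\<close>, \<open>A1\<close> passes \<open>C2\<close>, and the resulting
    \<open>R'\<close> and \<open>R\<close> cancel across \<open>N\<close>.\<close>
  also have "\<dots> = B2 ** A2 ** C2 ** N ** (B1 ** A1 ** C1) ** R"
    by (simp only: assoc assoc_rules(2) A2B1 C2A1 comm'[symmetric] cancel)
  finally show ?thesis .
qed

lemma transposition_rules:
  "transpose (map_matrix h M) = map_matrix h (transpose M)" "transp1 (transp2 M) = transpose M"
  "transp2 M = transp1 (transpose M)"
  by (simp_all add: vec_eq_iff transpose_def transp1_def transp2_def map_matrix_nth)

lemma generic_symmetric:
  assumes "generic q x y"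
  shows "generic q (inverse x) y" "generic q x (inverse y)" "generic q y x"
proof -
  have nz: "x \<noteq> 0" "y \<noteq> 0" using assms unfolding generic_def by blast+
  show "generic q (inverse x) y" "generic q x (inverse y)" "generic q y x"
    using generic_denominators[OF assms] nz unfolding generic_def by auto
qed

lemma transp2_Rmat:
  assumes "x \<noteq> 0" "y \<noteq> 0"
  shows "transp2 (Rmat y (inverse x) (inverse q)) = transp2 (Rmat x (inverse y) (inverse q))"
  by (rule arg_cong[of _ _ transp2], rule Rmat_inverse_arguments[of x "inverse y", unfolded inverse_inverse_eq])
    (simp_all add: assms)

text \<open>The factor C is B at the inverse parameter, so the B-B and B-A relations are also used
  at inverted points; \<open>D\<close> and \<open>generic\<close> are closed under
  inversion.\<close>

lemma AA_dressing:
  fixes h :: "'k::field \<Rightarrow> 'a::ring_1" and A B :: "'k \<Rightarrow> 'a^('n::{finite,linorder})^('n::{finite,linorder})"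
  assumes h: "central_hom h" and gen: "generic q x y" and D: "x \<in> D" "y \<in> D" "\<And>u. u \<in> D \<Longrightarrow> inverse u \<in> D"
    and AA: "AA_fwd h q x y (A x) (A y) = AA_rev h q x y (A x) (A y)"
    and BB: "\<And>u v. u \<in> D \<Longrightarrow> v \<in> D \<Longrightarrow> generic q u v \<Longrightarrow>
      BB_fwd h q u v (B u) (B v) = BB_rev h q u v (B u) (B v)"
    and BA: "\<And>u v. u \<in> D \<Longrightarrow> v \<in> D \<Longrightarrow> generic q u v \<Longrightarrow>
      BA_rev h q u v (B u) (A v) = BA_fwd h q u v (B u) (A v)"
  defines "A' \<equiv> \<lambda>u. B u ** A u ** transpose (B (inverse u))"
  shows "AA_fwd h q x y (A' x) (A' y) = AA_rev h q x y (A' x) (A' y)"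
proof -
  have nz: "x \<noteq> 0" "y \<noteq> 0" using gen unfolding generic_def by blast+
  note gens = generic_symmetric[OF gen]
  define R where "R u v = map_matrix h (Rmat u v q :: 'k^('n \<times> 'n)^('n \<times> 'n))" for u v
  define N where "N u v = map_matrix h (transp1 (Rmat u v q :: 'k^('n \<times> 'n)^('n \<times> 'n)))" for u v
  define R' where "R' = map_matrix h (Rmat x y (inverse q) :: 'k^('n \<times> 'n)^('n \<times> 'n))"
  have R_swap: "swap_spaces (R u v) = map_matrix h (Rmat v u (inverse q))" for u v
    unfolding R_def swap_spaces_products Rmat_swap_spaces by (rule refl)
  have N_swap: "swap_spaces (N u v) = N u v" for u v
    unfolding N_def swap_spaces_products swap_spaces_transp1_Rmat by (rule refl)
  \<comment> \<open>Exchanging the spaces together with \<open>x\<close> and \<open>y\<close>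
    therefore leaves \<open>N\<close> unchanged, which gives the second rule of each pair from the
    first.\<close>
  have N_flip: "N (inverse y) x = N (inverse x) y"
    unfolding N_def using nz
    by (subst Rmat_inverse_arguments[of "inverse x" y, unfolded inverse_inverse_eq]) simp_all
  \<comment> \<open>The middle factor of the B-A relation is the same \<open>N\<close> as in the A-A
    relation.\<close>
  have t2: "map_matrix h (transp2 (Rmat v (inverse u) (inverse q))) = N (inverse u) v" for u v
    unfolding N_def transposition_rules(3) Rmat_transpose inverse_inverse_eq by (rule refl)
  have BB_t: "space1 (transpose (B u)) ** N u v ** space2 (B v) = space2 (B v) ** N u v ** space1 (transpose (B u))"
    if "u \<in> D" "v \<in> D" "generic q u v" for u v
    using arg_cong[OF BB[OF that], of transp1]
    unfolding BB_fwd_def BB_rev_def transp1_products[OF h] N_def .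
  have BA': "space2 (A v) ** space1 (B u) ** R u v = space1 (B u) ** N (inverse u) v ** space2 (A v)"
    if "u \<in> D" "v \<in> D" "generic q u v" for u v
    using BA[OF that] unfolding BA_fwd_def BA_rev_def t2 R_def .
  have BA_t: "space2 (A v) ** N (inverse u) v ** space1 (transpose (B (inverse u)))
      = R u v ** space1 (transpose (B (inverse u))) ** space2 (A v)"
    if "u \<in> D" "v \<in> D" "generic q u v" for u v
    using arg_cong[OF BA[OF D(3)[OF that(1)] that(2) generic_symmetric(1)[OF that(3)]], of transp1]
    unfolding BA_fwd_def BA_rev_def transp1_products[OF h] inverse_inverse_eq transposition_rules(2) Rmat_transpose
      N_def R_def .
  have swap: "M = M' \<Longrightarrow> swap_spaces M = swap_spaces M'" for M M' :: "'a^('n \<times> 'n)^('n \<times> 'n)"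
    by (rule arg_cong)
  have "R x y ** (space1 (B x) ** space1 (A x) ** space1 (transpose (B (inverse x)))) ** N (inverse x) y
        ** (space2 (B y) ** space2 (A y) ** space2 (transpose (B (inverse y))))
      = space2 (B y) ** space2 (A y) ** space2 (transpose (B (inverse y))) ** N (inverse x) y
        ** (space1 (B x) ** space1 (A x) ** space1 (transpose (B (inverse x)))) ** R x y"
  proof (rule dressed_exchange)
    show RR: "R x y ** R' = mat 1"
      unfolding R_def R'_def map_matrix_hom(1)[OF h, symmetric]
      using generic_denominators[OF gen, of x y] by (simp add: Rmat_unitary map_matrix_hom(2)[OF h])
    show R'R: "R' ** R x y = mat 1"
    proof -
      have "inverse q * x - q * y \<noteq> 0" "inverse q * y - q * x \<noteq> 0"
        using generic_denominators[OF gen, of x y] by simp_all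
      then have "q * x - inverse q * y \<noteq> 0" "q * y - inverse q * x \<noteq> 0" by auto
      then have "Rmat x y (inverse q) ** Rmat x y q = (mat 1 :: 'k^('n \<times> 'n)^('n \<times> 'n))"
        using Rmat_unitary[of "inverse q" x y] by simp
      then show ?thesis
        unfolding R_def R'_def map_matrix_hom(1)[OF h, symmetric] by (simp add: map_matrix_hom(2)[OF h])
    qed
    show "R x y ** N (inverse x) y = N (inverse x) y ** R x y"
      unfolding R_def N_def map_matrix_hom(1)[OF h, symmetric] Rmat_commute_transp1 by (rule refl)
    show "R x y ** space1 (A x) ** N (inverse x) y ** space2 (A y)
        = space2 (A y) ** N (inverse x) y ** space1 (A x) ** R x y"
      using AA unfolding AA_fwd_def AA_rev_def R_def N_def .
    show "R x y ** space1 (B x) ** space2 (B y) = space2 (B y) ** space1 (B x) ** R x y"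
      using BB[OF D(1,2) gen] unfolding BB_fwd_def BB_rev_def R_def .
    show "R x y ** space1 (transpose (B (inverse x))) ** space2 (transpose (B (inverse y)))
        = space2 (transpose (B (inverse y))) ** space1 (transpose (B (inverse x))) ** R x y"
    proof -
      \<comment> \<open>Full transposition of the B-B relation at the inverse parameters yields the
        rule with \<open>R'\<close>; multiplying by \<open>R x y\<close> on both sides turns it into
        the one with \<open>R x y\<close>.\<close>
      have "R' ** space2 (transpose (B (inverse y))) ** space1 (transpose (B (inverse x)))
          = space1 (transpose (B (inverse x))) ** space2 (transpose (B (inverse y))) ** R'"
        using arg_cong[OF BB[OF D(3)[OF D(1)] D(3)[OF D(2)] generic_symmetric(2)[OF gens(1)]], of transpose]
        unfolding BB_fwd_def BB_rev_def transpose_products[OF h] Rmat_transpose Rmat_inverse_arguments[OF nz]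
          R'_def by (rule sym)
      then have "R x y ** (R' ** space2 (transpose (B (inverse y))) ** space1 (transpose (B (inverse x)))) ** R x y
          = R x y ** (space1 (transpose (B (inverse x))) ** space2 (transpose (B (inverse y))) ** R') ** R x y"
        by (rule arg_cong)
      moreover have "R x y ** (R' ** Z) = Z" for Z :: "'a^('n \<times> 'n)^('n \<times> 'n)"
        by (simp add: matrix_mul_assoc RR)
      ultimately show ?thesis
        by (simp only: matrix_mul_assoc[symmetric] R'R matrix_mul_rid)
    qed
    show "space1 (transpose (B (inverse x))) ** N (inverse x) y ** space2 (B y)
        = space2 (B y) ** N (inverse x) y ** space1 (transpose (B (inverse x)))"
      by (rule BB_t[OF D(3)[OF D(1)] D(2) gens(1)])
    show "space2 (transpose (B (inverse y))) ** N (inverse x) y ** space1 (B x)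
        = space1 (B x) ** N (inverse x) y ** space2 (transpose (B (inverse y)))"
      using swap[OF BB_t[OF D(3)[OF D(2)] D(1) generic_symmetric(1)[OF gens(3)]]]
      unfolding swap_spaces_products N_swap N_flip .
    show "space1 (A x) ** space2 (B y) = space2 (B y) ** N (inverse x) y ** space1 (A x) ** R x y"
    proof -
      \<comment> \<open>The B-A relation at \<open>y\<close>, \<open>x\<close> with the spaces
        exchanged, which turns \<open>R y x\<close> into \<open>R'\<close>.\<close>
      have "space1 (A x) ** space2 (B y) ** R' = space2 (B y) ** N (inverse x) y ** space1 (A x)"
        using swap[OF BA'[OF D(2,1) gens(3)]]
        unfolding swap_spaces_products N_swap N_flip R_swap R'_def[symmetric] .
      from arg_cong[OF this, of "\<lambda>M. M ** R x y"] show ?thesis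
        by (simp add: matrix_mul_assoc[symmetric] R'R)
    qed
    show "space2 (A y) ** space1 (B x) ** R x y = space1 (B x) ** N (inverse x) y ** space2 (A y)"
      by (rule BA'[OF D(1,2) gen])
    show "R x y ** space1 (transpose (B (inverse x))) ** space2 (A y)
        = space2 (A y) ** N (inverse x) y ** space1 (transpose (B (inverse x)))"
      by (rule BA_t[OF D(1,2) gen, symmetric])
    show "space1 (A x) ** N (inverse x) y ** space2 (transpose (B (inverse y)))
        = R' ** space2 (transpose (B (inverse y))) ** space1 (A x)"
      using swap[OF BA_t[OF D(2,1) gens(3)]]
      unfolding swap_spaces_products N_swap N_flip R_swap R'_def[symmetric] .
  qed
  then show ?thesis
    unfolding AA_fwd_def AA_rev_def A'_def space_matrix_mult R_def N_def .
qed

theorem lemma9p1: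
  fixes h :: "'k::field \<Rightarrow> 'a::{ring_1, t2_space, topological_ab_group_add, topological_semigroup_mult}"
    and q :: 'k and D :: "'k set"
    and a b :: "nat \<Rightarrow> 'a^('n::{finite,linorder})^('n::{finite,linorder})"
  defines "A \<equiv> gen_mat h a" and "B \<equiv> gen_mat h b"
  defines "A' \<equiv> (\<lambda>lam. B lam ** A lam ** transpose (B (inverse lam)))"
  assumes "central_hom h" and "q \<noteq> 0"
    and "\<And>lam. lam \<in> D \<Longrightarrow> lam \<noteq> 0 \<and> inverse lam \<in> D"
    and "\<And>lam. lam \<in> D \<Longrightarrow> gen_summable h a lam \<and> gen_summable h b lam"
    and "\<And>lam mu. lam \<in> D \<Longrightarrow> mu \<in> D \<Longrightarrow> generic q lam mu \<Longrightarrow>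
           AA_fwd h q lam mu (A lam) (A mu) = AA_rev h q lam mu (A lam) (A mu)"
    and "\<And>lam mu. lam \<in> D \<Longrightarrow> mu \<in> D \<Longrightarrow> generic q lam mu \<Longrightarrow>
           BB_fwd h q lam mu (B lam) (B mu) = BB_rev h q lam mu (B lam) (B mu)"
    and "\<And>lam mu. lam \<in> D \<Longrightarrow> mu \<in> D \<Longrightarrow> generic q lam mu \<Longrightarrow>
           BA_rev h q lam mu (B lam) (A mu) = BA_fwd h q lam mu (B lam) (A mu)"
  shows "(\<forall>lam mu. generic q lam mu \<longrightarrow>
            transp2 (Rmat mu (inverse lam) (inverse q)) =
              (transp2 (Rmat lam (inverse mu) (inverse q)) :: 'k^('n \<times> 'n)^('n \<times> 'n)))
       \<and> (\<forall>P Q S l1 l2 l3. generic q l1 l2 \<longrightarrow> generic q l1 l3 \<longrightarrow> generic q l2 l3 \<longrightarrow>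
            jacobi_consistent TYPE('n) q P Q S l1 l2 l3)
       \<and> (\<forall>lam\<in>D. \<forall>mu\<in>D. generic q lam mu \<longrightarrow>
            AA_fwd h q lam mu (A' lam) (A' mu) = AA_rev h q lam mu (A' lam) (A' mu))"
proof (intro conjI allI ballI impI)
  fix lam mu :: 'k
  assume "generic q lam mu"
  then show "transp2 (Rmat mu (inverse lam) (inverse q)) =
      (transp2 (Rmat lam (inverse mu) (inverse q)) :: 'k^('n \<times> 'n)^('n \<times> 'n))"
    unfolding generic_def by (blast intro: transp2_Rmat)
next
  fix P Q S and l1 l2 l3 :: 'k
  assume "generic q l1 l2" "generic q l1 l3" "generic q l2 l3"
  then show "jacobi_consistent TYPE('n) q P Q S l1 l2 l3" by (rule jacobi_consistent)
next
  fix lam mu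
  assume "lam \<in> D" "mu \<in> D" "generic q lam mu"
  with assms(4,6,8-10) show "AA_fwd h q lam mu (A' lam) (A' mu) = AA_rev h q lam mu (A' lam) (A' mu)"
    unfolding A'_def by (intro AA_dressing[where D = D]) blast+
qed

end
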